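(* Let $k\geq 3$ be an odd integer and let $n,s$ be integers with $3\leq s\leq n-2$. Then $smp^{k}(A_{n,s})=s(n-s)$.
   Context: The arrangement graph $A_{n,s}$ ($n\geq 2$, $1\leq s\leq n-1$) has as vertices all sequences $[a_1,\dots,a_s]$ of $s$ distinct elements of $\{1,\dots,n\}$, two vertices being adjacent iff they differ in exactly one position; it is $s(n-s)$-regular. An integer $k$-matching of $G$ is a function $h:E(G)\to\{0,1,\dots,k\}$ with $\sum_{e\in\Gamma(v)}h(e)\leq k$ for all $v$ ($\Gamma(v)$ the edges incident with $v$); it is perfect if every vertex has sum $k$, and almost perfect if exactly one vertex has sum $k-1$ and all others have sum $k$. For $F\subseteq V(G)\cup E(G)$, $G-F$ is obtained by deleting the vertices of $F$ (with incident edges) and the edges of $F$. $smp^{k}(G)$ is the minimum size of $F\subseteq V(G)\cup E(G)$ such that $G-F$ has neither a perfect nor an almost perfect integer $k$-matching. *)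

theory Defs
  imports Main
begin

text \<open>A (finite simple) graph is a pair (V, E) of a vertex set and a set of edges,
  each edge being a 2-element subset of V.\<close>

type_synonym 'a graph = "'a set \<times> 'a set set"

definition verts :: "'a graph \<Rightarrow> 'a set" where "verts G = fst G"
definition edges :: "'a graph \<Rightarrow> 'a set set" where "edges G = snd G"

definition arr_verts :: "nat \<Rightarrow> nat \<Rightarrow> nat list set" where
  "arr_verts n s = {xs. length xs = s \<and> distinct xs \<and> set xs \<subseteq> {1..n}}"

definition arrangement_graph :: "nat \<Rightarrow> nat \<Rightarrow> nat list graph" where
  "arrangement_graph n s =
     (arr_verts n s,
      {{u, v} | u v. u \<in> arr_verts n s \<and> v \<in> arr_verts n s \<and>
                     card {i. i < s \<and> u ! i \<noteq> v ! i} = 1})"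

definition inc_sum :: "'a graph \<Rightarrow> ('a set \<Rightarrow> nat) \<Rightarrow> 'a \<Rightarrow> nat" where
  "inc_sum G h v = (\<Sum>e\<in>{e\<in>edges G. v \<in> e}. h e)"

definition int_k_matching :: "nat \<Rightarrow> 'a graph \<Rightarrow> ('a set \<Rightarrow> nat) \<Rightarrow> bool" where
  "int_k_matching k G h \<longleftrightarrow> (\<forall>e\<in>edges G. h e \<le> k) \<and> (\<forall>v\<in>verts G. inc_sum G h v \<le> k)"

definition perfect_int_k_matching :: "nat \<Rightarrow> 'a graph \<Rightarrow> ('a set \<Rightarrow> nat) \<Rightarrow> bool" where
  "perfect_int_k_matching k G h \<longleftrightarrow>
     int_k_matching k G h \<and> (\<forall>v\<in>verts G. inc_sum G h v = k)"

definition almost_perfect_int_k_matching :: "nat \<Rightarrow> 'a graph \<Rightarrow> ('a set \<Rightarrow> nat) \<Rightarrow> bool" where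
  "almost_perfect_int_k_matching k G h \<longleftrightarrow>
     int_k_matching k G h \<and>
     (\<exists>!u. u \<in> verts G \<and> inc_sum G h u = k - 1) \<and>
     (\<forall>v\<in>verts G. inc_sum G h v = k \<or> inc_sum G h v = k - 1)"

definition delete :: "'a graph \<Rightarrow> 'a set \<Rightarrow> 'a set set \<Rightarrow> 'a graph" where
  "delete G FV FE = (verts G - FV, {e \<in> edges G - FE. e \<inter> FV = {}})"

definition smp :: "nat \<Rightarrow> 'a graph \<Rightarrow> nat" where
  "smp k G = (LEAST m. \<exists>FV FE. FV \<subseteq> verts G \<and> FE \<subseteq> edges G \<and> card FV + card FE = m \<and>
      \<not> (\<exists>h. perfect_int_k_matching k (delete G FV FE) h) \<and>
      \<not> (\<exists>h. almost_perfect_int_k_matching k (delete G FV FE) h))"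

end

theory Submission
  imports Defs
begin

text \<open>
  Deleting all edges at one vertex isolates it, so \<open>s (n - s)\<close> faults suffice. Conversely, put
  \<open>d = s (n - s)\<close>. The key inequality is that a set of vertices and edges whose removal leaves
  \<open>c \<ge> 2\<close> components has at least \<open>d + c - 2\<close> elements. For vertex sets it is proved by induction
  on \<open>s\<close>, splitting the graph according to the first entry: in a minimal counterexample with
  \<open>c \<ge> 3\<close> every removed vertex has neighbours in three components, at most one of them through
  its first entry, so every copy of the smaller graph is either untouched or disconnected.
  Hence after fewer than \<open>d\<close> faults the removal of any further set \<open>S\<close> leaves at most \<open>card S + 1\<close>
  components, and Tutte's theorem (with Lovasz's proof) gives a perfect matching or a matching
  missing one vertex. In the second case, an alternating-tree argument together with the partition
  into cliques yields adjacent \<open>x\<close>, \<open>y\<close> and matchings \<open>f\<close>, \<open>g\<close> missing exactly \<open>x\<close> and \<open>y\<close>;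
  then \<open>(k+1)/2 f + (k-1)/2 g + (k-1)/2 {x,y}\<close> is almost perfect.

  Components are handled throughout as labellings that are constant along the remaining edges;
  a perfect matching is encoded by the involution exchanging matched vertices.
\<close>

section \<open>Separators of arrangement graphs\<close>

text \<open>The alphabet \<open>A\<close> is arbitrary because fixing the first entry
  \<open>a\<close> leaves a copy of the same kind of graph over \<open>A - {a}\<close>, to which an
  induction hypothesis applies.\<close>

definition arrs :: "'a set \<Rightarrow> nat \<Rightarrow> 'a list set" where
  "arrs A s = {xs. length xs = s \<and> distinct xs \<and> set xs \<subseteq> A}"

text \<open>The neighbours of \<open>x\<close> are the sequences \<open>x[i := a]\<close> with
  \<open>a\<close> not in \<open>x\<close>, so \<open>l\<close> is a labelling constant on the
  components left after deleting \<open>T\<close>. Different components may share a label; an upper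
  bound on the number of labels, valid for every such \<open>l\<close>, is thus one on the number of
  components.\<close>

definition compat :: "'a set \<Rightarrow> nat \<Rightarrow> 'a list set \<Rightarrow> ('a list \<Rightarrow> 'c) \<Rightarrow> bool" where
  "compat A s T l \<longleftrightarrow>
     (\<forall>x\<in>arrs A s - T. \<forall>i<s. \<forall>a\<in>A - set x. x[i := a] \<notin> T \<longrightarrow> l (x[i := a]) = l x)"

definition slice :: "'a \<Rightarrow> 'a list set \<Rightarrow> 'a list set" where
  "slice a T = {xs. a # xs \<in> T}"

section \<open>Counting sequences and slicing by the first entry\<close>

lemma arrs_Cons: "a # xs \<in> arrs A (Suc s) \<longleftrightarrow> a \<in> A \<and> xs \<in> arrs (A - {a}) s"
  by (auto simp: arrs_def)

lemma arrs_SucE: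
  assumes "x \<in> arrs A (Suc s)"
  obtains a xs where "x = a # xs" "a \<in> A" "xs \<in> arrs (A - {a}) s"
  using assms by (cases x) (auto simp: arrs_Cons, auto simp: arrs_def)

lemma finite_arrs: "finite A \<Longrightarrow> finite (arrs A s)"
  unfolding arrs_def by (rule finite_subset[OF _ finite_lists_length_eq[of A s]]) auto

lemma arrs_update:
  assumes "x \<in> arrs A s" "i < s" "a \<in> A - set x"
  shows "x[i := a] \<in> arrs A s"
  using assms set_update_subset_insert[of x i a]
  by (auto simp: arrs_def intro!: distinct_list_update)

lemma card_arrs_Suc:
  assumes "finite A" "card A = m + s"
  shows "card (arrs A (Suc s)) = m * card (arrs A s)"
proof -
  have "card (arrs A (Suc s)) = card (\<Union>xs\<in>arrs A s. (\<lambda>a. a # xs) ` (A - set xs))"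
    by (rule arg_cong[of _ _ card], rule set_eqI, case_tac x) (auto simp: arrs_def)
  also have "\<dots> = (\<Sum>xs\<in>arrs A s. card ((\<lambda>a. a # xs) ` (A - set xs)))"
    using assms by (intro card_UN_disjoint) (auto simp: finite_arrs)
  also have "\<dots> = (\<Sum>xs\<in>arrs A s. m)"
  proof (intro sum.cong refl)
    fix xs assume "xs \<in> arrs A s"
    then have "card (A - set xs) = m"
      using assms by (subst card_Diff_subset) (auto simp: arrs_def distinct_card)
    then show "card ((\<lambda>a. a # xs) ` (A - set xs)) = m"
      by (simp add: card_image inj_on_def)
  qed
  finally show ?thesis by (simp add: mult.commute)
qed

text \<open>The cardinality is the product \<open>p (p+1) ... (p+r-1)\<close>, where
  \<open>p\<close> is the smallest factor, and the other factors multiply to at least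
  \<open>r + 1\<close>. The bound is used to see that two slices share many tails.\<close>

lemma card_arrs_ge:
  assumes "finite A" "card A + 1 = p + r" "2 \<le> r" "2 \<le> p"
  shows "(r + 1) * p \<le> card (arrs A r)"
  using assms(3,2,4)
proof (induction r arbitrary: p rule: dec_induct)
  case base
  have "arrs A 0 = {[]}" by (auto simp: arrs_def)
  then have "card (arrs A 2) = p * (p + 1)"
    using card_arrs_Suc[OF assms(1), of p 1] card_arrs_Suc[OF assms(1), of "p+1" 0] base
    by (simp add: numeral_2_eq_2)
  moreover have "3 * p \<le> (p + 1) * p" using base by (intro mult_le_mono1) simp
  ultimately have "3 * p \<le> card (arrs A 2)" by simp
  then show ?case by simp
next
  case (step r)
  have "card A = p + r" using step.prems by simp
  then have "card (arrs A (Suc r)) = p * card (arrs A r)"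
    by (intro card_arrs_Suc assms(1))
  moreover have "(r + 1) * (p + 1) \<le> card (arrs A r)"
    using step.prems by (intro step.IH) auto
  moreover have "Suc r + 1 \<le> (r + 1) * (p + 1)" using step.prems by (simp add: algebra_simps)
  ultimately have "p * (Suc r + 1) \<le> card (arrs A (Suc r))" by (metis le_trans mult_le_mono2)
  then show ?case by (simp only: mult.commute)
qed

lemma slice_subset: "T \<subseteq> arrs A (Suc s) \<Longrightarrow> slice a T \<subseteq> arrs (A - {a}) s"
  by (auto simp: slice_def arrs_Cons dest!: subsetD)

lemma card_eq_sum_slice:
  assumes "finite A" "T \<subseteq> arrs A (Suc s)"
  shows "card T = (\<Sum>a\<in>A. card (slice a T))"
proof -
  have "finite T" using assms finite_arrs finite_subset by blast
  have "T = (\<Union>a\<in>A. (#) a ` slice a T)"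
  proof (intro set_eqI iffI)
    fix x assume "x \<in> T"
    with assms(2) obtain a xs where "x = a # xs" "a \<in> A" by (blast elim: arrs_SucE)
    with \<open>x \<in> T\<close> show "x \<in> (\<Union>a\<in>A. (#) a ` slice a T)" by (auto simp: slice_def)
  qed (auto simp: slice_def)
  then have "card T = card (\<Union>a\<in>A. (#) a ` slice a T)" by simp
  also have "\<dots> = (\<Sum>a\<in>A. card ((#) a ` slice a T))"
    using assms finite_subset[OF slice_subset[OF assms(2)] finite_arrs]
    by (intro card_UN_disjoint) auto
  finally show ?thesis by (simp add: card_image)
qed

lemma compat_slice:
  assumes "compat A (Suc s) T l" "a \<in> A"
  shows "compat (A - {a}) s (slice a T) (\<lambda>xs. l (a # xs))"
  unfolding compat_def
proof (intro ballI allI impI)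
  fix xs i b assume *: "xs \<in> arrs (A - {a}) s - slice a T" "i < s" "b \<in> A - {a} - set xs"
    "xs[i := b] \<notin> slice a T"
  have "l ((a # xs)[Suc i := b]) = l (a # xs)"
    using assms * unfolding compat_def
    by (intro assms(1)[unfolded compat_def, rule_format]) (auto simp: arrs_Cons slice_def)
  then show "l (a # xs[i := b]) = l (a # xs)" by simp
qed

lemma compat_cross:
  assumes "compat A (Suc s) T l" "a \<in> A" "b \<in> A" "zs \<in> arrs (A - {a, b}) s"
    "a # zs \<notin> T" "b # zs \<notin> T"
  shows "l (a # zs) = l (b # zs)"
proof (cases "a = b")
  case False
  have "zs \<in> arrs (A - {a}) s" "b \<notin> set zs" using assms(4) by (auto simp: arrs_def)
  then have "l ((a # zs)[0 := b]) = l (a # zs)"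
    using assms False
    by (intro assms(1)[unfolded compat_def, rule_format]) (auto simp: arrs_Cons)
  then show ?thesis by simp
qed simp

lemma compat_comp: "compat A s T l \<Longrightarrow> compat A s T (\<lambda>x. g (l x))"
  by (auto simp: compat_def)

text \<open>The sequences that differ from \<open>t\<close> only in position \<open>i\<close> form a
  clique, so the survivors among them share a label. The vertex \<open>t\<close> itself may be
  deleted.\<close>

lemma compat_same_line:
  assumes "compat A s T l" "t \<in> arrs A s" "i < s" "a \<in> A - set t" "b \<in> A - set t"
    "t[i := a] \<notin> T" "t[i := b] \<notin> T"
  shows "l (t[i := a]) = l (t[i := b])"
proof (cases "a = b")
  case False
  have "b \<notin> set (t[i := a])" using assms set_update_subset_insert[of t i a] False by auto
  then have "l ((t[i := a])[i := b]) = l (t[i := a])"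
    using assms arrs_update[of t A s i a]
    by (intro assms(1)[unfolded compat_def, rule_format]) auto
  then show ?thesis by simp
qed simp

definition seen :: "'a set \<Rightarrow> nat \<Rightarrow> 'a list set \<Rightarrow> ('a list \<Rightarrow> 'c) \<Rightarrow> 'a list \<Rightarrow> 'c set" where
  "seen A s T l t = {l (t[i := a]) |i a. i < s \<and> a \<in> A - set t \<and> t[i := a] \<notin> T}"

lemma list_update_sym_ex:
  assumes "x \<in> arrs A s" "i < s" "a \<in> A - set x" 
  shows "x ! i \<in> A - set (x[i := a])" "(x[i := a])[i := x ! i] = x"
proof -
  have "distinct x" "length x = s" "set x \<subseteq> A" using assms by (auto simp: arrs_def)
  moreover have "x ! i \<in> set x" using \<open>length x = s\<close> assms by auto
  moreover have "x ! i \<notin> set (x[i := a])"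
  proof
    assume "x ! i \<in> set (x[i := a])"
    then obtain j where "j < s" "x[i := a] ! j = x ! i"
      using \<open>length x = s\<close> by (auto simp: in_set_conv_nth)
    then show False using assms \<open>distinct x\<close> \<open>length x = s\<close> \<open>x ! i \<in> set x\<close>
      by (cases "i = j") (auto simp: nth_eq_iff_index_eq)
  qed
  ultimately show "x ! i \<in> A - set (x[i := a])" "(x[i := a])[i := x ! i] = x" by auto
qed

text \<open>A deleted vertex can be restored once \<open>g\<close> merges all labels of its
  surviving neighbours into one label \<open>m\<close>, which the restored vertex then
  receives.\<close>

lemma compat_put_back:
  assumes "compat A s T l" "t \<in> T" "T \<subseteq> arrs A s" "\<And>c. c \<in> seen A s T l t \<Longrightarrow> g c = m"
  shows "compat A s (T - {t}) (\<lambda>x. if x = t then m else g (l x))"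
  unfolding compat_def
proof (intro ballI allI impI)
  fix x i a
  assume x: "x \<in> arrs A s - (T - {t})" "i < s" "a \<in> A - set x" "x[i := a] \<notin> T - {t}"
  have ne: "x[i := a] \<noteq> x"
  proof
    assume "x[i := a] = x"
    have len: "i < length x" using x assms(3) by (auto simp: arrs_def)
    then have "x[i := a] ! i = a" by simp
    then have "x ! i = a" using \<open>x[i := a] = x\<close> by simp
    then show False using x(3) len nth_mem by blast
  qed
  show "(if x[i := a] = t then m else g (l (x[i := a]))) = (if x = t then m else g (l x))"
  proof (cases "x = t")
    case True
    then have "l (x[i := a]) \<in> seen A s T l t" using x ne by (auto simp: seen_def)
    then show ?thesis using assms True ne by auto
  next
    case False
    then have xT: "x \<notin> T" "x \<in> arrs A s" using x by auto
    show ?thesis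
    proof (cases "x[i := a] = t")
      case True
      have "l x \<in> seen A s T l t"
        unfolding seen_def mem_Collect_eq
        using list_update_sym_ex[OF xT(2) x(2,3)] xT True x(2) by (intro exI[of _ i] exI[of _ "x ! i"]) auto
      then show ?thesis using assms False True by auto
    next
      case False
      have "l (x[i := a]) = l x"
        using x xT False by (intro assms(1)[unfolded compat_def, rule_format]) auto
      then show ?thesis using False \<open>x \<noteq> t\<close> by auto
    qed
  qed
qed

section \<open>Connectivity: separators leaving two label classes\<close>

lemma arrs_one_same_label:
  assumes "compat A 1 T l" "x \<in> arrs A 1 - T" "y \<in> arrs A 1 - T"
  shows "l x = l y"
proof -
  obtain a b where ab: "x = [a]" "y = [b]" "a \<in> A" "b \<in> A"
    using assms(2,3) by (auto simp: arrs_def length_Suc_conv)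
  show ?thesis
  proof (cases "a = b")
    case False
    then have "l (x[0 := b]) = l x"
      using assms(2,3) ab by (intro assms(1)[unfolded compat_def, rule_format]) auto
    then show ?thesis using ab by simp
  qed (use ab in simp)
qed

text \<open>Rows are coloured by \<open>R\<close> and columns by \<open>C\<close>; an off-diagonal
  cell whose row and column colours differ must lie in \<open>T\<close>. If both colours occur among
  the rows and among the columns, almost every column and almost every row contributes its own such
  cell.\<close>

lemma two_colour_count:
  assumes "finite A" "card A = p + 2"
    and "a0 \<in> A" "R a0" "b0 \<in> A" "\<not> R b0" "u0 \<in> A" "C u0" "v0 \<in> A" "\<not> C v0"
    and "finite T" and T: "\<And>a u. a \<in> A \<Longrightarrow> u \<in> A \<Longrightarrow> a \<noteq> u \<Longrightarrow> R a \<noteq> C u \<Longrightarrow> [a, u] \<in> T"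
  shows "2 * p \<le> card T"
proof -
  \<comment> \<open>If some letter has both colours true, take \<open>u = a\<close>; if some letter
    has both false, take \<open>v = b\<close>; otherwise \<open>C\<close> is the negation of
    \<open>R\<close> and \<open>u = b\<close>, \<open>v = a\<close> works. The only cells that
    \<open>X\<close> and \<open>Y\<close> below could share are \<open>[b, u]\<close> and
    \<open>[a, v]\<close>, and each of the three cases excludes both.\<close>
  obtain a b u v where *: "a \<in> A" "R a" "b \<in> A" "\<not> R b" "u \<in> A" "C u" "v \<in> A" "\<not> C v"
    "u = a \<or> v = b \<or> u = b \<and> v = a"
    using assms by metis
  define X where "X = (\<lambda>w. [if C w then b else a, w]) ` (A - {a, b})"
  define Y where "Y = (\<lambda>w. [w, if R w then v else u]) ` (A - {u, v})"
  have "a \<noteq> b" "u \<noteq> v" using * by auto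
  then have "card (A - {a, b}) = p" "card (A - {u, v}) = p"
    using assms(1,2) * by (simp_all add: card_Diff_subset)
  then have "card X = p" "card Y = p"
    unfolding X_def Y_def by (subst card_image; simp add: inj_on_def)+
  moreover have "X \<inter> Y = {}"
    using * \<open>a \<noteq> b\<close> \<open>u \<noteq> v\<close> unfolding X_def Y_def by (auto split: if_splits)
  moreover have "X \<subseteq> T" "Y \<subseteq> T"
    unfolding X_def Y_def using * by (auto intro!: T split: if_splits)
  moreover have "finite X" "finite Y" using assms(1) by (simp_all add: X_def Y_def)
  ultimately have "card (X \<union> Y) = p + p" "card (X \<union> Y) \<le> card T"
    using \<open>finite T\<close> card_mono[of T "X \<union> Y"] by (simp_all add: card_Un_disjoint)
  then show ?thesis by simp
qed

text \<open>For length 2 the sequences with a given first entry form a clique, and so do those with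
  a given second entry. Hence surviving cells give every row and every column a well-defined colour,
  and the count of mismatched cells applies.\<close>

lemma arrs_two_connectivity:
  assumes "finite A" "card A = p + 2" "T \<subseteq> arrs A 2" "compat A 2 T P"
    and "x \<in> arrs A 2 - T" "P x" "y \<in> arrs A 2 - T" "\<not> P y"
  shows "2 * p \<le> card T"
proof -
  define R where "R a \<longleftrightarrow> (\<exists>w. [a, w] \<in> arrs A 2 - T \<and> P [a, w])" for a
  define C where "C u \<longleftrightarrow> (\<exists>w. [w, u] \<in> arrs A 2 - T \<and> P [w, u])" for u
  have row: "P [a, w] = P [a, u]"
    if "[a, u] \<in> arrs A 2 - T" "[a, w] \<in> arrs A 2 - T" for a u w
  proof (cases "u = w")
    case False
    then have "P ([a, u][1 := w]) = P [a, u]"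
      using that by (intro assms(4)[unfolded compat_def, rule_format]) (auto simp: arrs_def)
    then show ?thesis by simp
  qed simp
  have col: "P [w, u] = P [a, u]"
    if "[a, u] \<in> arrs A 2 - T" "[w, u] \<in> arrs A 2 - T" for a u w
  proof (cases "a = w")
    case False
    then have "P ([a, u][0 := w]) = P [a, u]"
      using that by (intro assms(4)[unfolded compat_def, rule_format]) (auto simp: arrs_def)
    then show ?thesis by simp
  qed simp
  have RC: "R a = P [a, u]" "C u = P [a, u]" if "[a, u] \<in> arrs A 2 - T" for a u
    using row[OF that] col[OF that] that unfolding R_def C_def by blast+
  have T: "[a, u] \<in> T" if "a \<in> A" "u \<in> A" "a \<noteq> u" "R a \<noteq> C u" for a u
    using that RC[of a u] by (auto simp: arrs_def)
  obtain a0 u0 where x: "x = [a0, u0]" "a0 \<in> A" "u0 \<in> A"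
    using assms(5) by (auto simp: arrs_def numeral_2_eq_2 length_Suc_conv)
  obtain b0 v0 where y: "y = [b0, v0]" "b0 \<in> A" "v0 \<in> A"
    using assms(7) by (auto simp: arrs_def numeral_2_eq_2 length_Suc_conv)
  have "R a0" "C u0" "\<not> R b0" "\<not> C v0"
    using RC[of a0 u0] RC[of b0 v0] assms x y by auto
  moreover have "finite T" using assms finite_arrs finite_subset by blast
  ultimately show ?thesis
    using two_colour_count[OF assms(1,2), of a0 R b0 u0 C v0 T] T x y by blast
qed

lemma sum_slices_le:
  assumes "finite A" "T \<subseteq> arrs A (Suc s)" "B \<subseteq> A"
  shows "(\<Sum>a\<in>B. card (slice a T)) \<le> card T"
  using card_eq_sum_slice[OF assms(1,2)] sum_mono2[OF assms(1,3), of "\<lambda>a. card (slice a T)"]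
  by simp

lemma card_Diff_insert_set:
  assumes "finite A" "card A = p + Suc s" "c \<in> A" "zs \<in> arrs (A - {c}) s"
  shows "card (A - {c} - set zs) = p"
proof -
  have "card (set zs) = s" "set zs \<subseteq> A - {c}"
    using assms(4) by (auto simp: arrs_def distinct_card)
  then show ?thesis using assms by (simp add: card_Diff_subset)
qed

text \<open>A slice containing both colours costs \<open>s * p\<close> deletions by induction, so
  two such slices suffice. Two one-coloured slices of opposite colours cannot both keep a common
  tail, and there are at least \<open>(s + 1) * p\<close> common tails. What remains is one
  two-coloured slice \<open>c\<close> with all other slices of one colour \<open>\<beta>\<close>; a
  vertex of \<open>c\<close> of the other colour forces one deletion in each of \<open>p\<close>
  further slices.\<close>

lemma arrs_connectivity:
  assumes "2 \<le> s" "2 \<le> p" "finite A" "card A = p + s" "T \<subseteq> arrs A s" "compat A s T P"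
    and "x \<in> arrs A s - T" "P x" "y \<in> arrs A s - T" "\<not> P y"
  shows "s * p \<le> card T"
  using assms(1,3-)
proof (induction s arbitrary: A T P x y rule: dec_induct)
  case base
  then show ?case using arrs_two_connectivity by blast
next
  case (step s)
  define bad where "bad a \<longleftrightarrow> (\<exists>xs\<in>arrs (A - {a}) s - slice a T. P (a # xs)) \<and>
    (\<exists>xs\<in>arrs (A - {a}) s - slice a T. \<not> P (a # xs))" for a
  have bad: "s * p \<le> card (slice a T)" if a: "a \<in> A" "bad a" for a
  proof -
    obtain xs ys where xy: "xs \<in> arrs (A - {a}) s - slice a T" "P (a # xs)"
      "ys \<in> arrs (A - {a}) s - slice a T" "\<not> P (a # ys)"
      using a unfolding bad_def by blast
    show ?thesis
      by (rule step.IH[OF _ _ slice_subset[OF step.prems(3)]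
            compat_slice[OF step.prems(4) \<open>a \<in> A\<close>] xy])
         (use step.prems that in auto)
  qed
  have two: "card (slice a T) + card (slice b T) \<le> card T" if "a \<in> A" "b \<in> A" "a \<noteq> b" for a b
    using sum_slices_le[OF step.prems(1,3), of "{a, b}"] that by simp
  have good: "Suc s * p \<le> card T"
    if ab: "a \<in> A" "b \<in> A" "\<not> bad a" "\<not> bad b"
      and "xs \<in> arrs (A - {a}) s - slice a T" "P (a # xs)"
      and "ys \<in> arrs (A - {b}) s - slice b T" "\<not> P (b # ys)" for a b xs ys
  proof -
    have "a \<noteq> b" using that unfolding bad_def by blast
    have sub: "arrs (A - {a, b}) s \<subseteq> slice a T \<union> slice b T"
    proof
      fix zs assume zs: "zs \<in> arrs (A - {a, b}) s"
      show "zs \<in> slice a T \<union> slice b T"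
      proof (rule ccontr)
        assume n: "zs \<notin> slice a T \<union> slice b T"
        then have "P (a # zs) = P (b # zs)"
          using compat_cross[OF step.prems(4) ab(1,2) zs] by (auto simp: slice_def)
        moreover have "zs \<in> arrs (A - {a}) s" "zs \<in> arrs (A - {b}) s"
          using zs by (auto simp: arrs_def)
        ultimately show False using that n unfolding bad_def by blast
      qed
    qed
    have "finite (slice a T)" "finite (slice b T)"
      using finite_subset[OF slice_subset[OF step.prems(3)] finite_arrs] step.prems(1) by auto
    have "card (A - {a, b}) + 1 = p + s"
      using step.prems(1,2) ab assms(2) \<open>a \<noteq> b\<close> by (simp add: card_Diff_subset)
    then have "(s + 1) * p \<le> card (arrs (A - {a, b}) s)"
      using step.prems(1) step.hyps assms(2) by (intro card_arrs_ge) auto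
    also have "\<dots> \<le> card (slice a T \<union> slice b T)"
      using sub \<open>finite (slice a T)\<close> \<open>finite (slice b T)\<close> by (intro card_mono) auto
    also have "\<dots> \<le> card (slice a T) + card (slice b T)" by (rule card_Un_le)
    also have "\<dots> \<le> card T" using two ab \<open>a \<noteq> b\<close> by blast
    finally show ?thesis by simp
  qed
  obtain a0 xs0 where x: "x = a0 # xs0" "a0 \<in> A" "xs0 \<in> arrs (A - {a0}) s - slice a0 T"
    using step.prems(5) by (auto simp: slice_def elim!: arrs_SucE)
  obtain b0 ys0 where y: "y = b0 # ys0" "b0 \<in> A" "ys0 \<in> arrs (A - {b0}) s - slice b0 T"
    using step.prems(7) by (auto simp: slice_def elim!: arrs_SucE)
  show ?case
  proof (rule ccontr)
    assume "\<not> Suc s * p \<le> card T"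
    then have small: "card T < Suc s * p" by simp
    have "bad a0 \<or> bad b0"
      using good[OF x(2) y(2) _ _ x(3) _ y(3)] step.prems x y small by auto
    then obtain c where c: "c \<in> A" "bad c" using x y by blast
    have sp: "Suc s * p \<le> s * p + s * p"
      using step.hyps by simp
    have uniq: "\<not> bad a" if "a \<in> A" "a \<noteq> c" for a
      using two[OF that(1) c(1) that(2)] bad[OF that(1)] bad[OF c] small sp by linarith
    \<comment> \<open>Two surviving vertices of opposite colours outside slice \<open>c\<close>
      would lie in slices that are not \<open>bad\<close>, which \<open>good\<close> excludes for
      small \<open>T\<close>. Slices deleted entirely satisfy the claim vacuously.\<close>
    have "\<exists>\<beta>. \<forall>a\<in>A - {c}. \<forall>xs\<in>arrs (A - {a}) s - slice a T. P (a # xs) = \<beta>"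
      using good uniq small by (metis DiffE insertCI not_le)
    then obtain \<beta> where beta:
      "\<And>a xs. a \<in> A - {c} \<Longrightarrow> xs \<in> arrs (A - {a}) s - slice a T \<Longrightarrow> P (a # xs) = \<beta>"
      by blast
    obtain zs where zs: "zs \<in> arrs (A - {c}) s - slice c T" "P (c # zs) \<noteq> \<beta>"
      using c(2) unfolding bad_def by (cases \<beta>) blast+
    \<comment> \<open>The vertex \<open>a # zs\<close> is a neighbour of \<open>c # zs\<close> in a
      slice of colour \<open>\<beta>\<close>, so it cannot survive.\<close>
    have ne: "1 \<le> card (slice a T)" if a: "a \<in> A - {c} - set zs" for a
    proof -
      have "zs \<in> slice a T"
      proof (rule ccontr)
        assume n: "zs \<notin> slice a T"
        have "zs \<in> arrs (A - {c, a}) s" "zs \<in> arrs (A - {a}) s"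
          using zs a by (auto simp: arrs_def)
        then have "P (c # zs) = P (a # zs)"
          using n zs a c by (intro compat_cross[OF step.prems(4)]) (auto simp: slice_def)
        then show False using beta[of a zs] a n zs \<open>zs \<in> arrs (A - {a}) s\<close> by auto
      qed
      moreover have "finite (slice a T)"
        using finite_subset[OF slice_subset[OF step.prems(3)] finite_arrs] step.prems(1) by auto
      ultimately show ?thesis by (auto simp: Suc_le_eq card_gt_0_iff)
    qed
    have "p = card (A - {c} - set zs)"
      using card_Diff_insert_set[OF step.prems(1,2) c(1)] zs by auto
    also have "\<dots> = (\<Sum>a\<in>A - {c} - set zs. 1)" by simp
    also have "\<dots> \<le> (\<Sum>a\<in>A - {c} - set zs. card (slice a T))"
      by (rule sum_mono) (rule ne)
    finally have "p + card (slice c T) \<le> (\<Sum>a\<in>insert c (A - {c} - set zs). card (slice a T))"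
      using step.prems(1) by simp
    also have "\<dots> \<le> card T"
      by (rule sum_slices_le[OF step.prems(1,3)]) (use c in auto)
    finally show False using bad[OF c] small by simp
  qed
qed

section \<open>Separators leaving many components\<close>

lemma eq_if_card_less_two:
  assumes "finite S" "\<not> 2 \<le> card S" "x \<in> S" "y \<in> S"
  shows "x = y"
  using assms card_le_Suc0_iff_eq[of S] by (auto simp: not_le less_Suc_eq_le numeral_2_eq_2)

lemma finite_seen: "finite A \<Longrightarrow> finite (seen A s T l t)"
  by (rule finite_subset[of _ "(\<lambda>(i, a). l (t[i := a])) ` ({..<s} \<times> A)"]) (auto simp: seen_def)

text \<open>Changing a later entry stays inside slice \<open>a\<close>, while all changes of the
  first entry lie in one clique and so contribute a single label \<open>c\<close>.\<close>

lemma seen_Cons: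
  assumes "compat A (Suc s) T l" "a # xs \<in> arrs A (Suc s)"
  shows "\<exists>c. seen A (Suc s) T l (a # xs) \<subseteq>
    insert c ((\<lambda>ys. l (a # ys)) ` (arrs (A - {a}) s - slice a T))"
proof -
  define H where "H = {l (b # xs) |b. b \<in> A - set (a # xs) \<and> b # xs \<notin> T}"
  have "c = c'" if "c \<in> H" "c' \<in> H" for c c'
    using that compat_same_line[OF assms, of 0] by (auto simp: H_def)
  then obtain c where c: "H \<subseteq> {c}" by blast
  have "seen A (Suc s) T l (a # xs) \<subseteq>
      insert c ((\<lambda>ys. l (a # ys)) ` (arrs (A - {a}) s - slice a T))"
  proof
    fix z assume "z \<in> seen A (Suc s) T l (a # xs)"
    then obtain i b where z: "z = l ((a # xs)[i := b])" "i < Suc s" "b \<in> A - set (a # xs)"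
      "(a # xs)[i := b] \<notin> T" by (auto simp: seen_def)
    show "z \<in> insert c ((\<lambda>ys. l (a # ys)) ` (arrs (A - {a}) s - slice a T))"
    proof (cases i)
      case 0
      then have "z \<in> H" using z by (auto simp: H_def)
      then show ?thesis using c by auto
    next
      case (Suc j)
      then have "xs[j := b] \<in> arrs (A - {a}) s - slice a T"
        using z assms(2) arrs_update[of xs "A - {a}" s j b] by (auto simp: arrs_Cons slice_def)
      then show ?thesis using z Suc by auto
    qed
  qed
  then show ?thesis ..
qed

text \<open>The closing count for separators: \<open>b\<close> slices meet the separator of size
  \<open>t\<close>, each satisfies the induction hypothesis with \<open>D = s * p\<close>,
  \<open>S\<close> is the sum of their label counts, and \<open>c\<close> is the total number of
  labels. Each slice then pays \<open>D - 2\<close> plus its labels.\<close>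

lemma separator_size_arith:
  fixes b c t p D :: nat
  assumes "4 \<le> D" "2 \<le> p" "p + 1 \<le> b" "c \<le> 1 + S" "b * D + S \<le> t + 2 * b"
  shows "D + p + c \<le> t + 2"
proof -
  obtain e where e: "D = e + 4" using assms(1) le_Suc_ex by (metis add.commute)
  have "(p + 1) * (e + 2) \<le> b * (e + 2)" using assms(3) by (rule mult_le_mono1)
  moreover have "(p + 1) * (e + 2) = p * e + 2 * p + e + 2" by (simp add: algebra_simps)
  moreover have "b * D = b * (e + 2) + 2 * b" by (simp add: e algebra_simps)
  moreover have "1 * e \<le> p * e" using assms(2) by (intro mult_le_mono1) simp
  ultimately show ?thesis using assms(2,4,5) e by linarith
qed

text \<open>The outer induction is on \<open>s\<close>, where \<open>s = 1\<close> is vacuous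
  because the graph is complete; the inner one is on \<open>card T\<close>. Two labels are the
  connectivity bound. With at least three labels, a vertex of \<open>T\<close> that sees at most two
  of them can be put back at the cost of one label. Otherwise every vertex of \<open>T\<close> sees
  three labels, at least two of them inside its own slice, and the outer hypothesis is summed over
  all slices that meet \<open>T\<close>.\<close>

theorem arrs_separator_size:
  fixes l :: "'a list \<Rightarrow> 'c"
  assumes "1 \<le> s" "2 \<le> p" "finite A" "card A = p + s" "T \<subseteq> arrs A s" "compat A s T l"
    and "2 \<le> card (l ` (arrs A s - T))"
  shows "s * p + card (l ` (arrs A s - T)) \<le> card T + 2"
  using assms(1,3-)
proof (induction s arbitrary: A T l rule: dec_induct)
  case base
  then have "finite (l ` (arrs A 1 - T))" by (simp add: finite_arrs)
  then have "card (l ` (arrs A 1 - T)) \<le> Suc 0"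
    using card_le_Suc0_iff_eq[of "l ` (arrs A 1 - T)"] arrs_one_same_label[OF base(4)] by blast
  then show ?case using base(5) by linarith
next
  case (step s)
  from step.prems show ?case
  proof (induction "card T" arbitrary: T l rule: less_induct)
    case less
    let ?V = "arrs A (Suc s)"
    define C where "C = l ` (?V - T)"
    have finV: "finite ?V" using less.prems by (simp add: finite_arrs)
    then have finC: "finite C" and finT: "finite T"
      using less.prems by (auto simp: C_def intro: finite_subset)
    have fin_labels: "finite ((\<lambda>ys. l (a # ys)) ` (arrs (A - {a}) s - slice a T))" for a
      using less.prems(1) by (simp add: finite_arrs)
    have "2 \<le> card C" using less.prems by (simp add: C_def)
    have conn: "Suc s * p \<le> card T"
    proof -
      obtain c c' where "c \<in> C" "c' \<in> C" "c \<noteq> c'"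
        using \<open>2 \<le> card C\<close> card_le_Suc0_iff_eq[OF finC] by fastforce
      then obtain x y where xy: "x \<in> ?V - T" "y \<in> ?V - T" "l x \<noteq> l y"
        by (auto simp: C_def)
      show ?thesis
        by (rule arrs_connectivity[OF _ assms(2) less.prems(1,2,3)
              compat_comp[OF less.prems(4), of "\<lambda>c. c = l x"], of x y])
           (use xy step.hyps in auto)
    qed
    have "Suc s * p + card C \<le> card T + 2"
    proof (cases "card C = 2")
      case True
      then show ?thesis using conn by simp
    next
      case False
      then have C3: "3 \<le> card C" using \<open>2 \<le> card C\<close> by simp
      show ?thesis
      proof (cases "\<exists>t\<in>T. card (seen A (Suc s) T l t) \<le> 2")
        case True
        then obtain t where t: "t \<in> T" "card (seen A (Suc s) T l t) \<le> 2" by blast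
        have "\<exists>m m'. seen A (Suc s) T l t \<subseteq> {m, m'}"
        proof (cases "seen A (Suc s) T l t = {}")
          case False
          then obtain m where m: "m \<in> seen A (Suc s) T l t" by blast
          then have "card (seen A (Suc s) T l t - {m}) \<le> Suc 0" using t by simp
          then have "\<And>x y. x \<in> seen A (Suc s) T l t - {m} \<Longrightarrow> y \<in> seen A (Suc s) T l t - {m} \<Longrightarrow> x = y"
            using card_le_Suc0_iff_eq[of "seen A (Suc s) T l t - {m}"] finite_seen[OF less.prems(1)]
            by auto
          then show ?thesis by blast
        qed auto
        then obtain m m' where m: "seen A (Suc s) T l t \<subseteq> {m, m'}" by blast
        \<comment> \<open>Merging \<open>m'\<close> into \<open>m\<close> lets \<open>t\<close>
          return with label \<open>m\<close>, and at most the label \<open>m'\<close> is lost. Since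
          there were at least three labels, two remain and the inner hypothesis applies.\<close>
        define g where "g c = (if c = m' then m else c)" for c
        define l' where "l' x = (if x = t then m else g (l x))" for x
        have compat': "compat A (Suc s) (T - {t}) l'"
          unfolding l'_def using m t less.prems
          by (intro compat_put_back) (auto simp: g_def)
        have "C - {m'} \<subseteq> l' ` (?V - (T - {t}))"
        proof
          fix c assume c: "c \<in> C - {m'}"
          then obtain x where "x \<in> ?V - T" "c = l x" by (auto simp: C_def)
          then have "x \<in> ?V - (T - {t})" "l' x = c" using t c by (auto simp: l'_def g_def)
          then show "c \<in> l' ` (?V - (T - {t}))" by blast
        qed
        then have "card (C - {m'}) \<le> card (l' ` (?V - (T - {t})))"
          using finV by (intro card_mono) auto
        then have C': "card C \<le> Suc (card (l' ` (?V - (T - {t}))))"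
          using finC by (cases "m' \<in> C") (simp_all add: card_Diff_singleton)
        have cT: "card T = Suc (card (T - {t}))" by (rule card.remove[OF finT t(1)])
        moreover have "Suc s * p + card (l' ` (?V - (T - {t}))) \<le> card (T - {t}) + 2"
        proof (rule less.hyps[OF _ less.prems(1,2) _ compat'])
          show "card (T - {t}) < card T" using cT by simp
          show "T - {t} \<subseteq> ?V" using less.prems(3) by blast
          show "2 \<le> card (l' ` (?V - (T - {t})))" using C' C3 by simp
        qed
        ultimately show ?thesis using C' by linarith
      next
        case False
        define L where "L a = (\<lambda>ys. l (a # ys)) ` (arrs (A - {a}) s - slice a T)" for a
        have IH: "s * p + card (L a) \<le> card (slice a T) + 2" if "a \<in> A" "2 \<le> card (L a)" for a
          unfolding L_def
          by (rule step.IH[OF _ _ slice_subset[OF less.prems(3)]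
                compat_slice[OF less.prems(4) \<open>a \<in> A\<close>]])
             (use less.prems that in \<open>auto simp: L_def\<close>)
        define B where "B = {a \<in> A. slice a T \<noteq> {}}"
        have "B \<subseteq> A" "finite B" using less.prems by (auto simp: B_def)
        have B2: "2 \<le> card (L a)" if aB: "a \<in> B" for a
        proof -
          obtain xs where "a # xs \<in> T" using aB by (auto simp: B_def slice_def)
          then obtain c where c: "seen A (Suc s) T l (a # xs) \<subseteq> insert c (L a)"
            using seen_Cons[OF less.prems(4), of a xs] less.prems(3) unfolding L_def by blast
          have "finite (insert c (L a))" using fin_labels by (simp add: L_def)
          from card_mono[OF this c]
          have "card (seen A (Suc s) T l (a # xs)) \<le> card (insert c (L a))" .
          also have "\<dots> \<le> Suc (card (L a))"
            using fin_labels[of a] by (simp add: L_def card_insert_if)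
          finally have "card (seen A (Suc s) T l (a # xs)) \<le> Suc (card (L a))" .
          moreover have "\<not> card (seen A (Suc s) T l (a # xs)) \<le> 2"
            using False \<open>a # xs \<in> T\<close> by blast
          ultimately show ?thesis by linarith
        qed
        \<comment> \<open>For \<open>s = 1\<close> the slices are complete graphs with at most one
          label each, against \<open>B2\<close>.\<close>
        have "s \<noteq> 1"
        proof
          assume "s = 1"
          have "T \<noteq> {}" using conn assms(2) by auto
          then obtain t where "t \<in> T" by blast
          then obtain a xs where "a # xs \<in> T" "a \<in> A"
            using less.prems(3) by (blast elim: arrs_SucE)
          then have "a \<in> B" by (auto simp: B_def slice_def)
          have "card (L a) \<le> Suc 0"
            using arrs_one_same_label[OF compat_slice[OF less.prems(4) \<open>a \<in> A\<close>, unfolded \<open>s = 1\<close>]]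
              card_le_Suc0_iff_eq[OF fin_labels[of a]] unfolding L_def \<open>s = 1\<close> by blast
          then show False using B2[OF \<open>a \<in> B\<close>] by simp
        qed
        then have "2 \<le> s" using step.hyps by simp
        then have D4: "4 \<le> s * p" using assms(2) mult_le_mono[of 2 s 2 p] by simp
        \<comment> \<open>If every slice meets \<open>T\<close>, both bounds are immediate.
          Otherwise all untouched slices carry one common label \<open>x0\<close>, and any vertex
          \<open>b # zs\<close> with another label forces slice \<open>b\<close> and the slices of
          its \<open>p\<close> neighbours \<open>a # zs\<close> to meet \<open>T\<close>.\<close>
        have BC: "p + 1 \<le> card B \<and> card C \<le> 1 + (\<Sum>a\<in>B. card (L a))"
        proof (cases "B = A")
          case True
          have "C \<subseteq> (\<Union>a\<in>A. L a)"
          proof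
            fix c assume "c \<in> C"
            then obtain x where "x \<in> ?V" "x \<notin> T" "c = l x" by (auto simp: C_def)
            then show "c \<in> (\<Union>a\<in>A. L a)" by (auto simp: L_def slice_def elim!: arrs_SucE)
          qed
          then have "card C \<le> card (\<Union>a\<in>A. L a)"
            using less.prems(1) fin_labels by (intro card_mono) (auto simp: L_def)
          also have "\<dots> \<le> (\<Sum>a\<in>A. card (L a))" by (rule card_UN_le) (rule less.prems(1))
          finally show ?thesis using True less.prems(2) by simp
        next
          case False
          then obtain a0 where a0: "a0 \<in> A" "a0 \<notin> B" using \<open>B \<subseteq> A\<close> by blast
          have same: "l (a # xs) = l (a # ys)"
            if "a \<in> A - B" "xs \<in> arrs (A - {a}) s" "ys \<in> arrs (A - {a}) s" for a xs ys
          proof -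
            have "slice a T = {}" using that by (auto simp: B_def)
            \<comment> \<open>With two labels the outer hypothesis would give
              \<open>s * p + 2 \<le> 0 + 2\<close> for the untouched slice, impossible as
              \<open>s * p\<close> is at least 4.\<close>
            then have "\<not> 2 \<le> card (L a)" using IH[of a] D4 that by auto
            then show ?thesis using fin_labels[of a] that \<open>slice a T = {}\<close>
              by (intro eq_if_card_less_two[of "L a"]) (auto simp: L_def)
          qed
          have "\<exists>x0. \<forall>a\<in>A - B. \<forall>xs\<in>arrs (A - {a}) s. l (a # xs) = x0"
          proof -
            have "l (a # xs) = l (a0 # ys)"
              if a: "a \<in> A - B" and xs: "xs \<in> arrs (A - {a}) s" and ys: "ys \<in> arrs (A - {a0}) s"
              for a xs ys
            proof (cases "a = a0")
              case True
              then show ?thesis using same that by blast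
            next
              case False
              then have "card (A - {a, a0}) + 1 = p + s"
                using a a0 less.prems(1,2) assms(2) by (simp add: card_Diff_subset)
              then have "(s + 1) * p \<le> card (arrs (A - {a, a0}) s)"
                using less.prems(1) \<open>2 \<le> s\<close> assms(2) by (intro card_arrs_ge) auto
              then have "arrs (A - {a, a0}) s \<noteq> {}" using assms(2) by auto
              then obtain zs where zs: "zs \<in> arrs (A - {a, a0}) s" by blast
              then have zs': "zs \<in> arrs (A - {a}) s" "zs \<in> arrs (A - {a0}) s"
                by (auto simp: arrs_def)
              have "slice a T = {}" "slice a0 T = {}" using a a0 by (auto simp: B_def)
              then have "l (a # zs) = l (a0 # zs)"
                using a a0 by (intro compat_cross[OF less.prems(4) _ _ zs]) (auto simp: slice_def)
              then show ?thesis using same[OF a xs zs'(1)] same[of a0, OF _ ys zs'(2)] a0 by auto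
            qed
            moreover have "(s + 1) * (p + 1) \<le> card (arrs (A - {a0}) s)"
              using less.prems(1,2) a0 \<open>2 \<le> s\<close> assms(2) by (intro card_arrs_ge) auto
            then have "arrs (A - {a0}) s \<noteq> {}" by auto
            then obtain ys where "ys \<in> arrs (A - {a0}) s" by blast
            ultimately show ?thesis by blast
          qed
          then obtain x0 where x0: "\<And>a xs. a \<in> A - B \<Longrightarrow> xs \<in> arrs (A - {a}) s \<Longrightarrow> l (a # xs) = x0"
            by blast
          have sub: "C \<subseteq> insert x0 (\<Union>a\<in>B. L a)"
          proof
            fix c assume "c \<in> C"
            then obtain x where "x \<in> ?V" "x \<notin> T" "c = l x" by (auto simp: C_def)
            then obtain a xs where a: "a \<in> A" "xs \<in> arrs (A - {a}) s" "c = l (a # xs)" "a # xs \<notin> T"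
              by (auto elim!: arrs_SucE)
            then show "c \<in> insert x0 (\<Union>a\<in>B. L a)"
              using x0[of a xs] by (cases "a \<in> B") (auto simp: L_def slice_def)
          qed
          have "card C \<le> card (insert x0 (\<Union>a\<in>B. L a))"
            using sub \<open>finite B\<close> fin_labels by (intro card_mono) (auto simp: L_def)
          also have "\<dots> \<le> Suc (card (\<Union>a\<in>B. L a))"
            using \<open>finite B\<close> fin_labels by (simp add: L_def card_insert_if)
          also have "card (\<Union>a\<in>B. L a) \<le> (\<Sum>a\<in>B. card (L a))" by (rule card_UN_le) fact
          finally have 1: "card C \<le> 1 + (\<Sum>a\<in>B. card (L a))" by simp
          have "\<not> C \<subseteq> {x0}"
          proof
            assume "C \<subseteq> {x0}"
            then have "card C \<le> card {x0}" by (intro card_mono) auto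
            then show False using C3 by simp
          qed
          then obtain z where "z \<in> ?V" "z \<notin> T" "l z \<noteq> x0" by (auto simp: C_def)
          then obtain b zs where b: "b \<in> A" "zs \<in> arrs (A - {b}) s" "b # zs \<notin> T" "l (b # zs) \<noteq> x0"
            by (auto elim!: arrs_SucE)
          then have "b \<in> B" using x0[of b zs] by auto
          have "A - {b} - set zs \<subseteq> B"
          proof
            fix a assume a: "a \<in> A - {b} - set zs"
            show "a \<in> B"
            proof (rule ccontr)
              assume "a \<notin> B"
              then have "slice a T = {}" using a by (auto simp: B_def)
              have zs: "zs \<in> arrs (A - {b, a}) s" "zs \<in> arrs (A - {a}) s"
                using a b by (auto simp: arrs_def)
              have "l (b # zs) = l (a # zs)"
                using a b \<open>slice a T = {}\<close>
                by (intro compat_cross[OF less.prems(4) _ _ zs(1)]) (auto simp: slice_def)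
              then show False using b x0[of a zs] zs \<open>a \<notin> B\<close> a by auto
            qed
          qed
          then have "insert b (A - {b} - set zs) \<subseteq> B" using \<open>b \<in> B\<close> by simp
          then have "card (insert b (A - {b} - set zs)) \<le> card B"
            using \<open>finite B\<close> by (rule card_mono[rotated])
          then have "p + 1 \<le> card B"
            using card_Diff_insert_set[OF less.prems(1,2) b(1,2)] less.prems(1) by simp
          with 1 show ?thesis by simp
        qed
        have "(\<Sum>a\<in>B. s * p + card (L a)) \<le> (\<Sum>a\<in>B. card (slice a T) + 2)"
          using IH B2 \<open>B \<subseteq> A\<close> by (intro sum_mono) auto
        then have "card B * (s * p) + (\<Sum>a\<in>B. card (L a)) \<le> (\<Sum>a\<in>B. card (slice a T)) + 2 * card B"
          unfolding sum.distrib sum_constant by (simp only: mult.commute of_nat_id)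
        moreover have "(\<Sum>a\<in>B. card (slice a T)) \<le> card T"
          by (rule sum_slices_le[OF less.prems(1,3) \<open>B \<subseteq> A\<close>])
        ultimately have "card B * (s * p) + (\<Sum>a\<in>B. card (L a)) \<le> card T + 2 * card B"
          by linarith
        then have "s * p + p + card C \<le> card T + 2"
          by (rule separator_size_arith[OF D4 assms(2) conjunct1[OF BC] conjunct2[OF BC]])
        then show ?thesis by simp
      qed
    qed
    then show ?case unfolding C_def .
  qed
qed

section \<open>Tutte's theorem\<close>

definition pm :: "'a set \<Rightarrow> ('a \<Rightarrow> 'a \<Rightarrow> bool) \<Rightarrow> ('a \<Rightarrow> 'a) \<Rightarrow> bool" where
  "pm V E f \<longleftrightarrow> (\<forall>v\<in>V. f v \<in> V \<and> f (f v) = v \<and> E v (f v))"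

definition constant_along :: "'a set \<Rightarrow> ('a \<Rightarrow> 'a \<Rightarrow> bool) \<Rightarrow> ('a \<Rightarrow> 'c) \<Rightarrow> bool" where
  "constant_along X E cls \<longleftrightarrow> (\<forall>x\<in>X. \<forall>y\<in>X. E x y \<longrightarrow> cls x = cls y)"

definition odd_classes :: "'a set \<Rightarrow> ('a \<Rightarrow> 'c) \<Rightarrow> 'c set" where
  "odd_classes X cls = {c. odd (card {x \<in> X. cls x = c})}"

lemma odd_classes_subset: "odd_classes X cls \<subseteq> cls ` X"
proof
  fix c assume "c \<in> odd_classes X cls"
  then have "{x \<in> X. cls x = c} \<noteq> {}" unfolding odd_classes_def by (intro notI) simp
  then show "c \<in> cls ` X" by blast
qed

lemma finite_odd_classes: "finite X \<Longrightarrow> finite (odd_classes X cls)"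
  by (rule finite_subset[OF odd_classes_subset]) simp

lemma even_card_odd_classes:
  assumes "finite X"
  shows "even (card (odd_classes X cls)) \<longleftrightarrow> even (card X)"
proof -
  have "card X = (\<Sum>c\<in>cls ` X. card {x \<in> X. cls x = c})"
    using sum.image_gen[OF assms, of "\<lambda>_. 1 :: nat" cls] by simp
  moreover have "odd_classes X cls = {c \<in> cls ` X. odd (card {x \<in> X. cls x = c})}"
    using odd_classes_subset[of X cls] by (auto simp: odd_classes_def)
  ultimately show ?thesis using assms by (simp add: even_sum_iff)
qed

lemma pm_insert_pair:
  assumes "pm (Z - {x, y}) R f" "x \<in> Z" "y \<in> Z" "x \<noteq> y" "R x y" "R y x"
  shows "pm Z R (f(x := y, y := x))"
  using assms unfolding pm_def by auto

lemma pm_mono: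
  assumes "pm V E f" "\<And>x y. x \<in> V \<Longrightarrow> y \<in> V \<Longrightarrow> E x y \<Longrightarrow> E' x y"
  shows "pm V E' f"
  using assms unfolding pm_def by blast

text \<open>In this graph the classes of \<open>W\<close> are cliques and \<open>U\<close> is joined
  to everything. Pairs within a class are matched first, which preserves the odd classes; when every
  class is a single vertex, the bound says \<open>card W \<le> card U\<close>, so each left-over
  vertex gets a partner in \<open>U\<close>. The rest of \<open>U\<close> has even size and is
  matched within itself.\<close>

lemma pm_cliques:
  assumes "finite W" "finite U" "W \<inter> U = {}" "even (card (W \<union> U))"
    and "card (odd_classes W cls) \<le> card U"
  shows "\<exists>f. pm (W \<union> U) (\<lambda>v w. v \<noteq> w \<and> (v \<in> U \<or> w \<in> U \<or> cls v = cls w)) f"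
  using assms
proof (induction "card (W \<union> U)" arbitrary: W U rule: less_induct)
  case less
  let ?R = "\<lambda>U v w. v \<noteq> w \<and> (v \<in> U \<or> w \<in> U \<or> cls v = cls w)"
  have ext: "\<exists>f. pm (W \<union> U) (?R U) f"
    if xy: "x \<in> W \<union> U" "y \<in> W \<union> U" "x \<noteq> y" "?R U x y"
      and WU': "W' \<subseteq> W" "U' \<subseteq> U" "W' \<union> U' = W \<union> U - {x, y}" "W' \<inter> U' = {}"
      and odd': "card (odd_classes W' cls) \<le> card U'" for x y W' U'
  proof -
    have c: "card (W \<union> U) = card (W' \<union> U') + 2"
    proof -
      have "card (W \<union> U - {x, y}) = card (W \<union> U) - card {x, y}"
        using xy by (intro card_Diff_subset) auto
      moreover have "card {x, y} \<le> card (W \<union> U)"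
        using xy less.prems by (intro card_mono) auto
      ultimately show ?thesis using WU'(3) xy(3) by simp
    qed
    have "\<exists>f. pm (W' \<union> U') (?R U') f"
    proof (rule less.hyps)
      show "card (W' \<union> U') < card (W \<union> U)" "even (card (W' \<union> U'))"
        using c less.prems(4) by simp_all
      show "finite W'" "finite U'" using WU'(1,2) less.prems(1,2) by (auto intro: finite_subset)
    qed (use WU' odd' in auto)
    then obtain f where f: "pm (W' \<union> U') (?R U') f" ..
    have "pm (W \<union> U - {x, y}) (?R U) f"
      unfolding WU'(3)[symmetric] by (rule pm_mono[OF f]) (use WU'(2) in auto)
    then show ?thesis using pm_insert_pair[of "W \<union> U" x y "?R U" f] xy by auto
  qed
  show ?case
  proof (cases "inj_on cls W")
    case False
    then obtain x y where xy: "x \<in> W" "y \<in> W" "x \<noteq> y" "cls x = cls y"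
      by (auto simp: inj_on_def)
    have "odd_classes (W - {x, y}) cls = odd_classes W cls"
    proof -
      have "odd (card {v \<in> W - {x, y}. cls v = c}) \<longleftrightarrow> odd (card {v \<in> W. cls v = c})" for c
      proof (cases "c = cls x")
        case True
        have "{v \<in> W. cls v = c} = insert x (insert y {v \<in> W - {x, y}. cls v = c})"
          using xy True by auto
        then show ?thesis using xy less.prems(1) by simp
      next
        case False
        then have "{v \<in> W - {x, y}. cls v = c} = {v \<in> W. cls v = c}" using xy by auto
        then show ?thesis by simp
      qed
      then show ?thesis by (simp add: odd_classes_def)
    qed
    then show ?thesis
      using xy less.prems by (intro ext[of x y "W - {x, y}" U]) auto
  next
    case True
    have odd_inj: "odd_classes X cls = cls ` X" if "X \<subseteq> W" for X
    proof -
      have "{x \<in> X. cls x = cls v} = {v}" if "v \<in> X" for v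
        using True \<open>X \<subseteq> W\<close> that by (auto simp: inj_on_def)
      then show ?thesis using odd_classes_subset[of X cls] by (auto simp: odd_classes_def)
    qed
    have card_odd: "card (odd_classes X cls) = card X" if "X \<subseteq> W" for X
      using odd_inj[OF that] card_image[OF inj_on_subset[OF True that]] by simp
    show ?thesis
    proof (cases "W = {}")
      case False
      then obtain w where w: "w \<in> W" by blast
      have "card W \<le> card U" using card_odd[of W] less.prems by simp
      then have "U \<noteq> {}" using False less.prems(1) by auto
      then obtain u where u: "u \<in> U" by blast
      have "card (odd_classes (W - {w}) cls) \<le> card (U - {u})"
        using card_odd[of "W - {w}"] w u \<open>card W \<le> card U\<close> less.prems by auto
      then show ?thesis
        using w u less.prems by (intro ext[of w u "W - {w}" "U - {u}"]) auto
    next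
      case W: True
      show ?thesis
      proof (cases "U = {}")
        case True
        then show ?thesis using W by (auto simp: pm_def)
      next
        case False
        then obtain u where u: "u \<in> U" by blast
        have "U \<noteq> {u}" using less.prems W by auto
        then obtain u' where u': "u' \<in> U" "u' \<noteq> u" using u by blast
        then show ?thesis
          using W u card_odd[of "{}"] by (intro ext[of u u' "{}" "U - {u, u'}"]) auto
      qed
    qed
  qed
qed

section \<open>Lovasz's exchange argument\<close>

definition add_edge :: "('a \<Rightarrow> 'a \<Rightarrow> bool) \<Rightarrow> 'a \<Rightarrow> 'a \<Rightarrow> 'a \<Rightarrow> 'a \<Rightarrow> bool" where
  "add_edge E a c x y \<longleftrightarrow> E x y \<or> x = a \<and> y = c \<or> x = c \<and> y = a"

text \<open>If \<open>f\<close> avoids the added edge \<open>ac\<close>, or \<open>g\<close> the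
  added edge \<open>bd\<close>, that matching is already one of \<open>E\<close>. Otherwise the
  alternating cycle of \<open>f\<close> and \<open>g\<close> through \<open>bd\<close> either misses
  \<open>ac\<close>, and switching along it avoids both added edges, or it meets \<open>ac\<close>
  and is shortcut by \<open>ab\<close> or \<open>bc\<close>.\<close>

lemma pm_exchange:
  assumes fin: "finite V" and sym: "\<And>x y. E x y \<Longrightarrow> E y x" and irr: "\<And>x. \<not> E x x"
    and V: "a \<in> V" "b \<in> V" "c \<in> V" "d \<in> V"
    and ab: "E a b" and bc: "E b c" and ne: "a \<noteq> c" "b \<noteq> d" "d \<noteq> a" "d \<noteq> c"
    and f: "pm V (add_edge E a c) f" and g: "pm V (add_edge E b d) g"
  shows "\<exists>h. pm V E h"
proof (cases "f a = c \<and> g b = d")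
  case False
  have "f a \<noteq> c \<Longrightarrow> pm V E f"
    using f V unfolding pm_def add_edge_def by metis
  moreover have "g b \<noteq> d \<Longrightarrow> pm V E g"
    using g V unfolding pm_def add_edge_def by metis
  ultimately show ?thesis using False by blast
next
  case True
  have fV: "f x \<in> V" "f (f x) = x" and gV: "g x \<in> V" "g (g x) = x" if "x \<in> V" for x
    using f g that unfolding pm_def by blast+
  have fE: "E x (f x)" if "x \<in> V" "x \<noteq> a" "x \<noteq> c" for x
    using f that unfolding pm_def add_edge_def by blast
  have gE: "E x (g x)" if "x \<in> V" "x \<noteq> b" "x \<noteq> d" for x
    using g that unfolding pm_def add_edge_def by blast
  have fx: "f x \<noteq> x" if "x \<in> V" for x
    using f that irr ne unfolding pm_def add_edge_def by metis
  have gx: "g x \<noteq> x" if "x \<in> V" for x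
    using g that irr ne unfolding pm_def add_edge_def by metis
  have fa: "f a = c" "f c = a" and gb: "g b = d" "g d = b"
    using True fV(2)[OF V(1)] gV(2)[OF V(2)] by auto
  \<comment> \<open>The alternating walk from \<open>d\<close>. If it avoids \<open>a\<close> and \<open>c\<close>, use \<open>f\<close> on it and \<open>g\<close> elsewhere;
    otherwise cut it at the first visit to \<open>a\<close> or \<open>c\<close> and close it up through \<open>b\<close>.\<close>
  define w where "w i = ((g \<circ> f) ^^ i) d" for i
  have w0: "w 0 = d" and wS: "w (Suc i) = g (f (w i))" for i by (simp_all add: w_def)
  have wV: "w i \<in> V" for i by (induction i) (simp_all add: w0 wS V fV gV)
  have swap: "w (Suc j) = f (w i)" if "w (Suc i) = f (w j)" for i j
  proof -
    have "g (w (Suc i)) = f (w i)" using wV fV gV by (simp add: wS)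
    moreover have "g (w (Suc i)) = w (Suc j)" using that by (simp add: wS)
    ultimately show ?thesis by simp
  qed
  \<comment> \<open>If the walk met \<open>f (w j)\<close> after \<open>k\<close> further double
    steps, \<open>swap\<close> would move both ends inwards and reduce \<open>k\<close> by two,
    until \<open>f\<close> or \<open>g\<close> had a fixed point.\<close>
  have disj_le: "w (j + k) \<noteq> f (w j)" for j k
  proof (induction k arbitrary: j rule: less_induct)
    case (less k)
    consider "k = 0" | "k = 1" | k' where "k = Suc (Suc k')"
      by (metis One_nat_def not0_implies_Suc)
    then show ?case
    proof cases
      case 1
      then show ?thesis using fx[OF wV, of j] by auto
    next
      case 2
      then show ?thesis using gx[OF fV(1)[OF wV], of j] by (simp add: wS)
    next
      case 3
      show ?thesis
      proof
        assume "w (j + k) = f (w j)"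
        then have "w (Suc j) = f (w (Suc j + k'))" using swap[of "Suc j + k'" j] 3 by simp
        then have "w (Suc j + k') = f (w (Suc j))" using fV(2)[OF wV] by metis
        then show False using less.IH[of k' "Suc j"] 3 by simp
      qed
    qed
  qed
  have disj: "w i \<noteq> f (w j)" for i j
  proof (cases "j \<le> i")
    case True
    then show ?thesis using disj_le[of j "i - j"] by simp
  next
    case False
    then have "w j \<noteq> f (w i)" using disj_le[of i "j - i"] by simp
    then show ?thesis using fV(2)[OF wV] by metis
  qed
  have winj: "w i = w j" if "w (Suc i) = w (Suc j)" for i j
    using that fV gV wV unfolding wS by metis
  have period: "w (i + k) = w i \<Longrightarrow> w k = w 0" for i k
  proof (induction i)
    case (Suc i)
    from Suc.prems have "w (Suc (i + k)) = w (Suc i)" by simp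
    from winj[OF this] show ?case by (rule Suc.IH)
  qed simp
  have "\<not> inj w"
  proof
    assume "inj w"
    moreover have "finite (range w)" by (rule finite_subset[OF _ fin]) (use wV in auto)
    ultimately show False using finite_imageD infinite_UNIV_nat by blast
  qed
  \<comment> \<open>A repetition exists by finiteness, and injectivity of a double step moves it
    back to the start \<open>d\<close>. As \<open>g b = d\<close>, the last vertex before the return
    is \<open>b\<close>.\<close>
  then obtain i j where "i < j" "w i = w j" unfolding inj_def by (metis linorder_neqE_nat)
  then have "w (j - i) = d" "0 < j - i" using period[of i "j - i"] w0 by simp_all
  then obtain N where N: "w (Suc N) = d" by (metis gr0_implies_Suc)
  have bN: "b = f (w N)" using N gb gV fV wV unfolding wS by metis
  show ?thesis
  proof (cases "\<exists>i. w i \<in> {a, c}")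
    case False
    define C where "C = range w \<union> f ` range w"
    define h where "h x = (if x \<in> C then f x else g x)" for x
    have fC: "f x \<in> C" if xC: "x \<in> C" for x
    proof -
      from xC obtain i where "x = w i \<or> x = f (w i)" unfolding C_def by blast
      moreover have "w i \<in> C" "f (w i) \<in> C" unfolding C_def by blast+
      ultimately show ?thesis using fV(2)[OF wV, of i] by metis
    qed
    have acC: "a \<notin> C" "c \<notin> C"
      using False fa fV(2)[OF wV] unfolding C_def by (auto; metis insertCI)+
    have gC: "g x \<in> C" if xC: "x \<in> C" for x
    proof -
      consider i where "x = w i" | i where "x = f (w i)" using xC by (auto simp: C_def)
      then show ?thesis
      proof cases
        case 1
        have "g (w i) \<in> C"
        proof (cases i)
          case 0
          then show ?thesis using bN w0 gb by (auto simp: C_def)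
        next
          case (Suc k)
          then have "g (w i) = f (w k)" using wS gV(2)[OF fV(1)[OF wV]] by simp
          then show ?thesis by (auto simp: C_def)
        qed
        then show ?thesis using 1 by simp
      next
        case 2
        then have "g x = w (Suc i)" by (simp add: wS)
        then show ?thesis by (auto simp: C_def)
      qed
    qed
    have "d \<in> C" using w0 unfolding C_def by (metis UnI1 rangeI)
    then have "b \<in> C" using gC gb by metis
    have "pm V E h"
      unfolding pm_def
    proof
      fix x assume x: "x \<in> V"
      show "h x \<in> V \<and> h (h x) = x \<and> E x (h x)"
      proof (cases "x \<in> C")
        case True
        then have "x \<noteq> a" "x \<noteq> c" using acC by auto
        then show ?thesis using True fC fV x fE by (simp add: h_def)
      next
        case False
        then have "g x \<notin> C" using gC[of "g x"] gV x by auto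
        moreover have "x \<noteq> b" "x \<noteq> d" using False \<open>b \<in> C\<close> \<open>d \<in> C\<close> by auto
        ultimately show ?thesis using False gV x gE by (simp add: h_def)
      qed
    qed
    then show ?thesis by blast
  next
    case True
    define m where "m = (LEAST i. w i \<in> {a, c})"
    define e where "e = w m"
    have e: "e \<in> {a, c}" using LeastI_ex[OF True] by (simp add: e_def m_def)
    have least: "w i \<notin> {a, c}" if "i < m" for i
      using not_less_Least[of i "\<lambda>i. w i \<in> {a, c}"] that by (simp add: m_def)
    have "m \<noteq> 0" using e w0 ne by (cases m) (auto simp: e_def)
    define Q where "Q = w ` {..<m} \<union> f ` w ` {..<m}"
    have QI: "w i \<in> Q" "f (w i) \<in> Q" if "i < m" for i using that by (auto simp: Q_def)
    have fQ: "f x \<in> Q" if xQ: "x \<in> Q" for x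
    proof -
      from xQ obtain i where "i < m" "x = w i \<or> x = f (w i)" unfolding Q_def by blast
      then show ?thesis using QI[of i] fV(2)[OF wV, of i] by metis
    qed
    have acQ: "a \<notin> Q" "c \<notin> Q"
    proof -
      have "x \<notin> Q" if "x \<in> {a, c}" for x
      proof
        assume "x \<in> Q"
        then obtain i where i: "i < m" "x = w i \<or> x = f (w i)" by (auto simp: Q_def)
        then have "w i = x \<or> w i = f x" using fV(2)[OF wV] by auto
        then show False using least[OF i(1)] that fa by auto
      qed
      then show "a \<notin> Q" "c \<notin> Q" by auto
    qed
    then have eQ: "e \<notin> Q" using e by auto
    have "b \<noteq> e" using e ab bc irr by auto
    \<comment> \<open>If \<open>b\<close> were passed before step \<open>m\<close>, the walk would
      be back at \<open>d\<close> and repeat itself, so \<open>a\<close> or \<open>c\<close> would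
      have been reached earlier than step \<open>m\<close>.\<close>
    have bQ: "b \<notin> Q"
    proof
      assume "b \<in> Q"
      then obtain i where i: "i < m" "b = w i \<or> b = f (w i)" by (auto simp: Q_def)
      then have "b = f (w i)" using disj bN by metis
      then have wi: "w (Suc i) = w 0" using gb w0 by (simp add: wS)
      have per: "w (Suc i + k) = w k" for k by (induction k) (use wi wS in auto)
      obtain k where "m = Suc i + k" using i(1) less_imp_Suc_add by auto
      then show False using per[of k] e least[of k] by (auto simp: e_def)
    qed
    \<comment> \<open>The set \<open>Q\<close> with \<open>b\<close> and \<open>e\<close> added is
      closed under \<open>g\<close>: the ends \<open>d\<close> and \<open>f (w (m - 1))\<close> of
      the walk are joined by \<open>g\<close> to \<open>b\<close> and \<open>e\<close>. Hence
      \<open>g\<close> restricts to the complement, and \<open>e b\<close> is an edge of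
      \<open>E\<close> whether \<open>e\<close> is \<open>a\<close> or \<open>c\<close>.\<close>
    define h where "h x = (if x \<in> Q then f x else if x = e then b else if x = b then e else g x)" for x
    have "pm V E h"
      unfolding pm_def
    proof
      fix x assume x: "x \<in> V"
      have "e \<in> V" using wV by (simp add: e_def)
      show "h x \<in> V \<and> h (h x) = x \<and> E x (h x)"
      proof (cases "x \<in> Q")
        case True
        then have "x \<noteq> a" "x \<noteq> c" using acQ by auto
        then show ?thesis using True fQ fV x fE by (simp add: h_def)
      next
        case False
        have Eeb: "E e b" "E b e" using e ab bc sym by auto
        show ?thesis
        proof (cases "x = e \<or> x = b")
          case True
          then show ?thesis using eQ bQ \<open>b \<noteq> e\<close> Eeb V \<open>e \<in> V\<close> by (auto simp: h_def)
        next
          case neb: False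
          have g1: "g (w i) \<in> insert b Q" if "i \<le> m" for i
          proof (cases i)
            case 0
            then show ?thesis using w0 gb by simp
          next
            case (Suc k)
            then have "g (w i) = f (w k)" using wS gV(2)[OF fV(1)[OF wV]] by simp
            then show ?thesis using QI(2)[of k] that Suc by simp
          qed
          have g2: "g (f (w i)) \<in> insert e Q" if "i < m" for i
            using QI(1)[of "Suc i"] that by (cases "Suc i = m") (auto simp: wS[symmetric] e_def)
          have gg: "g (g x) = x" using gV x by simp
          have "g x \<notin> Q"
          proof
            assume "g x \<in> Q"
            then obtain i where "i < m" "g x = w i \<or> g x = f (w i)" by (auto simp: Q_def)
            then have "g (g x) \<in> insert b (insert e Q)" using g1[of i] g2[of i] by auto
            then show False using gg False neb by auto
          qed
          moreover have "g x \<noteq> e"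
          proof
            assume "g x = e"
            then have "x = g (w m)" using gg by (simp add: e_def)
            then show False using g1[of m] False neb by auto
          qed
          moreover have "g x \<noteq> b"
          proof
            assume "g x = b"
            then have "x = w 0" using gg gb w0 by simp
            then show False using QI(1)[of 0] \<open>m \<noteq> 0\<close> False by simp
          qed
          moreover have "x \<noteq> d" using QI(1)[of 0] \<open>m \<noteq> 0\<close> False w0 by auto
          ultimately show ?thesis using False neb gV x gE by (simp add: h_def)
        qed
      qed
    qed
    then show ?thesis by blast
  qed
qed

text \<open>An odd class of a labelling constant along edges is a union of components and so
  contains an odd component; hence this is equivalent to Tutte's usual condition. Labels are vertex
  sets because a definition must fix the label type, and closed neighbourhoods or singletons serve
  as labels later.\<close>

definition tutte_cond :: "'a set \<Rightarrow> ('a \<Rightarrow> 'a \<Rightarrow> bool) \<Rightarrow> bool" where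
  "tutte_cond V E \<longleftrightarrow> (\<forall>S\<subseteq>V. \<forall>cls :: 'a \<Rightarrow> 'a set. constant_along (V - S) E cls \<longrightarrow>
     card (odd_classes (V - S) cls) \<le> card S)"

lemma tutte_cond_mono:
  assumes "tutte_cond V E" "\<And>x y. E x y \<Longrightarrow> E' x y"
  shows "tutte_cond V E'"
  unfolding tutte_cond_def
proof (intro allI impI)
  fix S and cls :: "'a \<Rightarrow> 'a set" assume S: "S \<subseteq> V" "constant_along (V - S) E' cls"
  then have "constant_along (V - S) E cls" using assms(2) unfolding constant_along_def by auto
  then show "card (odd_classes (V - S) cls) \<le> card S"
    using assms(1) S(1) unfolding tutte_cond_def by simp
qed

text \<open>Induction on the number of non-adjacent pairs. With \<open>U\<close> the vertices
  adjacent to all others, either adjacency is transitive on the rest, which then splits into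
  cliques, or there is a path \<open>a b c\<close> without the edge \<open>ac\<close>. In the second
  case the graphs with one missing edge added have perfect matchings by induction, and the exchange
  argument combines two of them.\<close>

theorem tutte:
  fixes E :: "'a \<Rightarrow> 'a \<Rightarrow> bool"
  assumes "finite V" and "\<And>x y. E x y \<Longrightarrow> E y x" and "\<And>x. \<not> E x x" and "tutte_cond V E"
  shows "\<exists>f. pm V E f"
  using assms(2-)
proof (induction "card {(x, y). x \<in> V \<and> y \<in> V \<and> x \<noteq> y \<and> \<not> E x y}" arbitrary: E rule: less_induct)
  case less
  note sym = less.prems(1) and irr = less.prems(2)
  \<comment> \<open>The condition for the empty set and a constant labelling says that the number of
    vertices is even.\<close>
  have "odd_classes V (\<lambda>_. {} :: 'a set) = {}"
    using less.prems(3)[unfolded tutte_cond_def, rule_format, of "{}" "\<lambda>_. {} :: 'a set"]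
      finite_odd_classes[OF assms(1), of "\<lambda>_. {} :: 'a set"]
    by (simp add: constant_along_def)
  then have even: "even (card V)"
    using even_card_odd_classes[OF assms(1), of "\<lambda>_. {} :: 'a set"] by simp
  define U where "U = {u \<in> V. \<forall>v\<in>V. v \<noteq> u \<longrightarrow> E u v}"
  define W where "W = V - U"
  have UV: "U \<subseteq> V" "W \<union> U = V" "W \<inter> U = {}" "finite U" "finite W"
    using assms(1) by (auto simp: U_def W_def)
  show ?case
  proof (cases "\<forall>a\<in>W. \<forall>b\<in>W. \<forall>c\<in>W. E a b \<longrightarrow> E b c \<longrightarrow> a \<noteq> c \<longrightarrow> E a c")
    case True
    define cls where "cls x = {y \<in> W. y = x \<or> E x y}" for x
    have "constant_along (V - U) E cls"
      unfolding constant_along_def W_def[symmetric]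
    proof (intro ballI impI)
      fix x y assume xy: "x \<in> W" "y \<in> W" "E x y"
      have "E x v \<longleftrightarrow> E y v" if "v \<in> W" "v \<noteq> x" "v \<noteq> y" for v
        using True xy sym[OF xy(3)] that by metis
      then show "cls x = cls y" using xy sym[OF xy(3)] by (auto simp: cls_def)
    qed
    then have "card (odd_classes W cls) \<le> card U"
      using less.prems(3) UV(1) unfolding tutte_cond_def W_def by simp
    then obtain f where f: "pm V (\<lambda>v w. v \<noteq> w \<and> (v \<in> U \<or> w \<in> U \<or> cls v = cls w)) f"
      using pm_cliques[of W U cls] UV even by auto
    have "pm V E f"
    proof (rule pm_mono[OF f])
      fix x y assume xy: "x \<in> V" "y \<in> V" "x \<noteq> y \<and> (x \<in> U \<or> y \<in> U \<or> cls x = cls y)"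
      show "E x y"
      proof (cases "x \<in> U \<or> y \<in> U")
        case True
        then have "E x y \<or> E y x" using xy by (auto simp: U_def)
        then show ?thesis using sym by blast
      next
        case False
        then have "y \<in> cls y" "cls x = cls y" using xy by (auto simp: cls_def W_def)
        then show ?thesis using xy by (auto simp: cls_def)
      qed
    qed
    then show ?thesis by blast
  next
    case False
    then obtain a b c where abc: "a \<in> W" "b \<in> W" "c \<in> W" "E a b" "E b c" "a \<noteq> c" "\<not> E a c"
      by blast
    \<comment> \<open>The vertex \<open>b\<close> is not in \<open>U\<close>, so it has a
      non-neighbour \<open>d\<close>.\<close>
    then obtain d where d: "d \<in> V" "d \<noteq> b" "\<not> E b d"
      unfolding W_def U_def by blast
    have V: "a \<in> V" "b \<in> V" "c \<in> V" using abc by (auto simp: W_def)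
    have ex: "\<exists>f. pm V (add_edge E x y) f" if "x \<in> V" "y \<in> V" "x \<noteq> y" "\<not> E x y" for x y
    proof (rule less.hyps)
      have "{(u, v). u \<in> V \<and> v \<in> V \<and> u \<noteq> v \<and> \<not> add_edge E x y u v}
        \<subset> {(u, v). u \<in> V \<and> v \<in> V \<and> u \<noteq> v \<and> \<not> E u v}"
        using that by (auto simp: add_edge_def)
      moreover have "finite {(u, v). u \<in> V \<and> v \<in> V \<and> u \<noteq> v \<and> \<not> E u v}"
        by (rule finite_subset[of _ "V \<times> V"]) (use assms(1) in auto)
      ultimately show "card {(u, v). u \<in> V \<and> v \<in> V \<and> u \<noteq> v \<and> \<not> add_edge E x y u v}
        < card {(u, v). u \<in> V \<and> v \<in> V \<and> u \<noteq> v \<and> \<not> E u v}"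
        by (rule psubset_card_mono[rotated])
      show "tutte_cond V (add_edge E x y)"
        by (rule tutte_cond_mono[OF less.prems(3)]) (simp add: add_edge_def)
    qed (use that sym irr in \<open>auto simp: add_edge_def\<close>)
    obtain f where f: "pm V (add_edge E a c) f" using ex[of a c] V abc by blast
    obtain g where g: "pm V (add_edge E b d) g" using ex[of b d] V d by blast
    have "d \<noteq> a" "d \<noteq> c" using d abc sym by auto
    then show ?thesis
      using pm_exchange[OF assms(1) sym irr V(1,2,3) d(1) abc(4,5,6) d(2)[symmetric] _ _ f g]
      by blast
  qed
qed

text \<open>Tutte's theorem with deficiency one. On an even vertex set, the number of odd classes
  and \<open>card S\<close> have the same parity, so the slack of one disappears.\<close>

lemma pm_or_near_pm:
  assumes fin: "finite V" and sym: "\<And>x y. E x y \<Longrightarrow> E y x" and irr: "\<And>x. \<not> E x x"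
    and z: "z \<notin> V"
    and odd: "\<And>S (cls :: 'a \<Rightarrow> 'a set). S \<subseteq> V \<Longrightarrow> constant_along (V - S) E cls \<Longrightarrow>
      card (odd_classes (V - S) cls) \<le> card S + 1"
  shows "if even (card V) then \<exists>f. pm V E f else \<exists>u\<in>V. \<exists>f. pm (V - {u}) E f"
proof (cases "even (card V)")
  case True
  have "tutte_cond V E"
    unfolding tutte_cond_def
  proof (intro allI impI)
    fix S and cls :: "'a \<Rightarrow> 'a set" assume S: "S \<subseteq> V" "constant_along (V - S) E cls"
    have "finite S" "card S \<le> card V" using S(1) fin by (auto intro: finite_subset card_mono)
    then have "even (card (odd_classes (V - S) cls)) \<longleftrightarrow> even (card S)"
      using even_card_odd_classes[of "V - S" cls] fin True S by (simp add: card_Diff_subset)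
    moreover have "card (odd_classes (V - S) cls) \<le> card S + 1" by (rule odd[OF S])
    ultimately show "card (odd_classes (V - S) cls) \<le> card S"
      by (metis add.commute even_Suc le_Suc_eq plus_1_eq_Suc)
  qed
  then have "\<exists>f. pm V E f" by (intro tutte fin) (use sym irr in blast)+
  then show ?thesis using True by simp
next
  case False
  \<comment> \<open>Tutte's theorem is applied after adding a vertex \<open>z\<close> adjacent to everything.\<close>
  define E' where "E' x y \<longleftrightarrow> x \<noteq> y \<and> (x = z \<or> y = z \<or> E x y)" for x y
  have "tutte_cond (insert z V) E'"
    unfolding tutte_cond_def
  proof (intro allI impI)
    fix S and cls :: "'a \<Rightarrow> 'a set"
    assume S: "S \<subseteq> insert z V" "constant_along (insert z V - S) E' cls"
    have "finite S" using S(1) fin by (auto intro: finite_subset)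
    show "card (odd_classes (insert z V - S) cls) \<le> card S"
    proof (cases "z \<in> S")
      case True
      then have eq: "insert z V - S = V - (S - {z})" using z by auto
      have "constant_along (V - (S - {z})) E cls"
        using S(2) irr unfolding eq constant_along_def E'_def by metis
      then have "card (odd_classes (V - (S - {z})) cls) \<le> card (S - {z}) + 1"
        using S by (intro odd) auto
      moreover have "card S = Suc (card (S - {z}))" by (rule card.remove) fact+
      ultimately show ?thesis unfolding eq by linarith
    next
      case zS: False
      \<comment> \<open>When \<open>z\<close> survives it is joined to all other remaining vertices,
        so only one class is left. For empty \<open>S\<close>, parity rules out even that class
        being odd.\<close>
      have "odd_classes (insert z V - S) cls \<subseteq> {cls z}"
      proof -
        have "cls x = cls z" if "x \<in> insert z V - S" for x
          using S(2) that zS unfolding constant_along_def E'_def by (cases "x = z") auto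
        then show ?thesis using odd_classes_subset[of "insert z V - S" cls] by blast
      qed
      then have le1: "card (odd_classes (insert z V - S) cls) \<le> 1"
        using card_mono[of "{cls z}"] by force
      show ?thesis
      proof (cases "S = {}")
        case True
        then have "even (card (odd_classes (insert z V - S) cls))"
          using even_card_odd_classes[of "insert z V" cls] fin z False by simp
        then show ?thesis using le1 by (metis le_0_eq le_Suc_eq One_nat_def odd_one zero_le)
      next
        case False
        then have "1 \<le> card S" using \<open>finite S\<close> by (simp add: Suc_leI card_gt_0_iff)
        then show ?thesis using le1 by linarith
      qed
    qed
  qed
  then obtain f where f: "pm (insert z V) E' f"
    using tutte[of "insert z V" E'] fin sym unfolding E'_def by blast
  have f1: "f x \<in> insert z V" "f (f x) = x" "E' x (f x)" if "x \<in> insert z V" for x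
    using bspec[OF f[unfolded pm_def] that] by blast+
  have fz: "f z \<in> V" using f1(1,3)[of z] by (auto simp: E'_def)
  have "pm (V - {f z}) E f"
    unfolding pm_def
  proof
    fix v assume v: "v \<in> V - {f z}"
    then have fv: "f v \<in> insert z V" "f (f v) = v" "E' v (f v)" using f1[of v] by simp_all
    then have "f v \<noteq> z" using v by auto
    moreover have "f v \<noteq> f z"
    proof
      assume "f v = f z"
      then have "f (f v) = f (f z)" by (rule arg_cong)
      then have "v = z" unfolding fv(2) f1(2)[OF insertI1] .
      then show False using v z by simp
    qed
    moreover have "v \<noteq> z" using v z by auto
    ultimately show "f v \<in> V - {f z} \<and> f (f v) = v \<and> E v (f v)"
      using fv by (auto simp: E'_def)
  qed
  then show ?thesis using False fz by auto
qed

section \<open>Integer matchings from perfect matchings\<close>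

lemma pm_inj_on: "pm V E f \<Longrightarrow> inj_on f V"
  unfolding pm_def inj_on_def by metis

lemma pm_remove_pair:
  assumes "pm Z E g" "x \<in> Z"
  shows "pm (Z - {x, g x}) E g"
  unfolding pm_def
proof
  fix v assume v: "v \<in> Z - {x, g x}"
  have g: "g w \<in> Z" "g (g w) = w" "E w (g w)" if "w \<in> Z" for w
    using bspec[OF assms(1)[unfolded pm_def] that] by blast+
  have "g v \<noteq> x" "g v \<noteq> g x" using v g(2)[of v] g(2)[OF assms(2)] by auto
  then show "g v \<in> Z - {x, g x} \<and> g (g v) = v \<and> E v (g v)" using v g[of v] by simp
qed

text \<open>An alternating tree grown from \<open>u\<close>: \<open>D\<close> is a largest
  independent set of vertices, each of which can be the missed one. If \<open>f\<close> maps the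
  neighbourhood of \<open>D\<close> into \<open>D\<close>, injectivity and \<open>u \<in> D\<close>
  make the neighbourhood smaller than \<open>D\<close>. Otherwise a neighbour \<open>x\<close> has
  its partner \<open>y\<close> outside \<open>D\<close>, and rotating the matching makes
  \<open>y\<close> missable; then either \<open>y\<close> is adjacent to a vertex of
  \<open>D\<close>, or \<open>D\<close> could be enlarged by \<open>y\<close>.\<close>

lemma adjacent_missable_or_barrier:
  assumes fin: "finite V" and sym: "\<And>x y. E x y \<Longrightarrow> E y x" and irr: "\<And>x. \<not> E x x"
    and u: "u \<in> V" and f: "pm (V - {u}) E f"
  shows "(\<exists>x\<in>V. \<exists>y\<in>V. \<exists>g h. E x y \<and> pm (V - {x}) E g \<and> pm (V - {y}) E h) \<or>
    (\<exists>D\<subseteq>V. (\<forall>x\<in>D. \<forall>y\<in>D. \<not> E x y) \<and> card {x \<in> V. \<exists>v\<in>D. E v x} < card D)"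
proof -
  \<comment> \<open>The matching missing \<open>v\<close> must agree with \<open>f\<close> on every
    \<open>f\<close>-edge disjoint from \<open>D\<close>; this guarantees that the edge
    \<open>x y\<close> used for the rotation is still in it.\<close>
  define good where "good D \<longleftrightarrow> u \<in> D \<and> D \<subseteq> V \<and> (\<forall>x\<in>D. \<forall>y\<in>D. \<not> E x y) \<and>
    (\<forall>v\<in>D. \<exists>g. pm (V - {v}) E g \<and> (\<forall>w\<in>V. w \<notin> D \<longrightarrow> f w \<notin> D \<longrightarrow> g w = f w))" for D
  have "good {u}" using u f irr by (auto simp: good_def)
  moreover have "\<forall>D. good D \<longrightarrow> card D < Suc (card V)"
    using fin by (auto simp: good_def less_Suc_eq_le intro: card_mono)
  ultimately obtain D where D: "good D" and max: "\<And>D'. good D' \<Longrightarrow> card D' \<le> card D"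
    using ex_has_greatest_nat[of good "{u}" card "Suc (card V)"] by blast
  have uD: "u \<in> D" "D \<subseteq> V" and indep: "\<And>x y. x \<in> D \<Longrightarrow> y \<in> D \<Longrightarrow> \<not> E x y"
    using D by (auto simp: good_def)
  have miss: "\<exists>g. pm (V - {v}) E g \<and> (\<forall>w\<in>V. w \<notin> D \<longrightarrow> f w \<notin> D \<longrightarrow> g w = f w)" if "v \<in> D" for v
    using D that by (simp add: good_def)
  have finD: "finite D" using uD(2) fin by (rule finite_subset)
  define N where "N = {x \<in> V. \<exists>v\<in>D. E v x}"
  have fV: "f w \<in> V - {u}" "f (f w) = w" "E w (f w)" if "w \<in> V - {u}" for w
    using bspec[OF f[unfolded pm_def] that] by blast+
  have ND: "x \<notin> D" if "x \<in> N" for x using that indep by (auto simp: N_def)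
  have NV: "N \<subseteq> V - {u}" using ND uD by (auto simp: N_def)
  show ?thesis
  proof (cases "f ` N \<subseteq> D")
    case True
    have "f ` N \<subseteq> D - {u}" using True fV(1) NV by blast
    then have "card (f ` N) \<le> card (D - {u})" using finD by (intro card_mono) auto
    moreover have "card (f ` N) = card N"
      by (rule card_image[OF inj_on_subset[OF pm_inj_on[OF f] NV]])
    moreover have "card D = Suc (card (D - {u}))" by (rule card.remove[OF finD uD(1)])
    ultimately have "card N < card D" by linarith
    then show ?thesis using uD(2) indep unfolding N_def by blast
  next
    case False
    then obtain x where x: "x \<in> N" "f x \<notin> D" by blast
    then obtain v where v: "v \<in> D" "E v x" by (auto simp: N_def)
    obtain g where g: "pm (V - {v}) E g" "\<And>w. w \<in> V \<Longrightarrow> w \<notin> D \<Longrightarrow> f w \<notin> D \<Longrightarrow> g w = f w"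
      using miss[OF v(1)] by blast
    define y where "y = f x"
    have xV: "x \<in> V" "x \<notin> D" "x \<in> V - {u}" using x ND NV by auto
    have yV: "y \<in> V" "y \<notin> D" "f y = x" using fV[OF xV(3)] x(2) by (auto simp: y_def)
    have gx: "g x = y" using g(2)[OF xV(1,2) x(2)] by (simp add: y_def)
    have ne: "x \<noteq> v" "y \<noteq> v" "x \<noteq> y"
      using xV yV v fV(3)[OF xV(3)] irr[of x] by (auto simp: y_def)
    \<comment> \<open>The edge \<open>x y\<close> is replaced by \<open>v x\<close>, which moves the
      missed vertex from \<open>v\<close> to \<open>y\<close>.\<close>
    define g' where "g' = g(x := v, v := x)"
    have "pm (V - {v} - {x, g x}) E g" by (rule pm_remove_pair[OF g(1)]) (use xV ne in auto)
    moreover have "V - {v} - {x, g x} = V - {y} - {x, v}" using gx by auto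
    ultimately have g': "pm (V - {y}) E g'"
      unfolding g'_def using xV v ne uD sym[OF v(2)] by (intro pm_insert_pair) auto
    show ?thesis
    proof (cases "\<exists>w\<in>D. E w y")
      case True
      then obtain w where w: "w \<in> D" "E w y" by blast
      then obtain h where "pm (V - {w}) E h" using miss by blast
      then show ?thesis using w g' yV(1) uD(2) by blast
    next
      case False
      have "good (insert y D)"
        unfolding good_def
      proof (intro conjI ballI)
        fix a b assume "a \<in> insert y D" "b \<in> insert y D"
        then show "\<not> E a b" using indep False irr sym by blast
      next
        fix a assume a: "a \<in> insert y D"
        show "\<exists>g. pm (V - {a}) E g \<and>
          (\<forall>w\<in>V. w \<notin> insert y D \<longrightarrow> f w \<notin> insert y D \<longrightarrow> g w = f w)"
        proof (cases "a = y")
          case True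
          have "g' w = f w" if "w \<in> V" "w \<notin> insert y D" "f w \<notin> insert y D" for w
          proof -
            have "w \<noteq> x" "w \<noteq> v" using that v by (auto simp: y_def)
            then show ?thesis using g(2)[of w] that by (simp add: g'_def)
          qed
          then show ?thesis using g' True by blast
        next
          case False
          then have "a \<in> D" using a by simp
          from miss[OF this] show ?thesis by blast
        qed
      qed (use uD yV in auto)
      from max[OF this] show ?thesis using finD yV(2) by simp
    qed
  qed
qed

section \<open>Weights built from matchings\<close>

definition adjacent :: "'a graph \<Rightarrow> 'a \<Rightarrow> 'a \<Rightarrow> bool" where
  "adjacent G x y \<longleftrightarrow> x \<noteq> y \<and> {x, y} \<in> edges G"

definition matching_weight :: "'a set \<Rightarrow> ('a \<Rightarrow> 'a) \<Rightarrow> 'a set \<Rightarrow> nat" where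
  "matching_weight X f e = of_bool (\<exists>v\<in>X. e = {v, f v})"

lemma sum_of_bool_unique:
  assumes "finite F" "\<And>e. e \<in> F \<Longrightarrow> P e \<longleftrightarrow> Q \<and> e = e0" "Q \<Longrightarrow> e0 \<in> F"
  shows "(\<Sum>e\<in>F. of_bool (P e)) = (of_bool Q :: nat)"
proof -
  have "(\<Sum>e\<in>F. of_bool (P e) :: nat) = (\<Sum>e\<in>F. of_bool (Q \<and> e = e0))"
    using assms(2) by (intro sum.cong) auto
  also have "\<dots> = (\<Sum>e\<in>F. if e = e0 then of_bool Q else 0)"
    by (intro sum.cong) auto
  also have "\<dots> = of_bool Q" using assms(1,3) by (auto simp: sum.delta)
  finally show ?thesis .
qed

lemma inc_sum_matching_weight:
  assumes "finite (edges G)" "pm X (adjacent G) f"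
  shows "inc_sum G (matching_weight X f) v = of_bool (v \<in> X)"
  unfolding inc_sum_def matching_weight_def
proof (rule sum_of_bool_unique[where ?e0.0 = "{v, f v}"])
  have f: "f w \<in> X" "f (f w) = w" "adjacent G w (f w)" if "w \<in> X" for w
    using bspec[OF assms(2)[unfolded pm_def] that] by blast+
  show "v \<in> X \<Longrightarrow> {v, f v} \<in> {e \<in> edges G. v \<in> e}"
    using f(3) by (auto simp: adjacent_def)
  fix e assume e: "e \<in> {e \<in> edges G. v \<in> e}"
  show "(\<exists>w\<in>X. e = {w, f w}) \<longleftrightarrow> v \<in> X \<and> e = {v, f v}"
  proof
    assume "\<exists>w\<in>X. e = {w, f w}"
    then obtain w where w: "w \<in> X" "e = {w, f w}" by blast
    then have "v = w \<or> v = f w" using e by auto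
    then show "v \<in> X \<and> e = {v, f v}" using w f[OF w(1)] by auto
  qed auto
qed (use assms in simp)

lemma inc_sum_edge:
  assumes "finite (edges G)" "{x, y} \<in> edges G"
  shows "inc_sum G (\<lambda>e. of_bool (e = {x, y})) v = of_bool (v \<in> {x, y})"
  unfolding inc_sum_def
  by (rule sum_of_bool_unique[where ?e0.0 = "{x, y}"]) (use assms in auto)

text \<open>The bound on a single edge follows from the bound at one of its ends, since its weight
  is a summand there.\<close>

lemma int_k_matchingI:
  assumes "finite (edges G)" "\<And>e. e \<in> edges G \<Longrightarrow> e \<subseteq> verts G \<and> e \<noteq> {}"
    and "\<And>v. v \<in> verts G \<Longrightarrow> inc_sum G h v \<le> k"
  shows "int_k_matching k G h"
  unfolding int_k_matching_def
proof (intro conjI ballI)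
  fix e assume e: "e \<in> edges G"
  then obtain v where v: "v \<in> e" "v \<in> verts G" using assms(2)[OF e] by blast
  have "h e \<le> inc_sum G h v"
    unfolding inc_sum_def using assms(1) e v by (intro member_le_sum) auto
  then show "h e \<le> k" using assms(3)[OF v(2)] by simp
qed (rule assms(3))

lemma perfect_from_pm:
  assumes "finite (edges G)" "\<And>e. e \<in> edges G \<Longrightarrow> e \<subseteq> verts G \<and> e \<noteq> {}"
    and "pm (verts G) (adjacent G) f"
  shows "perfect_int_k_matching k G (\<lambda>e. k * matching_weight (verts G) f e)"
proof -
  have "inc_sum G (\<lambda>e. k * matching_weight (verts G) f e) v = k" if "v \<in> verts G" for v
    using inc_sum_matching_weight[OF assms(1,3), of v] that
    unfolding inc_sum_def by (simp add: sum_distrib_left[symmetric])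
  then show ?thesis
    unfolding perfect_int_k_matching_def using int_k_matchingI[OF assms(1,2)] by simp
qed

lemma almost_perfect_from_two_pms:
  assumes "finite (edges G)" "\<And>e. e \<in> edges G \<Longrightarrow> e \<subseteq> verts G \<and> e \<noteq> {}"
    and "x \<in> verts G" "y \<in> verts G" "adjacent G x y" "odd k"
    and "pm (verts G - {x}) (adjacent G) f" "pm (verts G - {y}) (adjacent G) g"
  shows "\<exists>h. almost_perfect_int_k_matching k G h"
proof -
  obtain j where k: "k = 2 * j + 1" using \<open>odd k\<close> by (auto elim: oddE)
  \<comment> \<open>The vertex \<open>x\<close> receives \<open>j + j = k - 1\<close>, the vertex
    \<open>y\<close> receives \<open>(j + 1) + j = k\<close>, and every other vertex also receives
    \<open>(j + 1) + j = k\<close>.\<close>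
  define h where "h e = (j + 1) * matching_weight (verts G - {x}) f e +
    j * matching_weight (verts G - {y}) g e + j * of_bool (e = {x, y})" for e
  have xy: "x \<noteq> y" "{x, y} \<in> edges G" using assms(5) by (auto simp: adjacent_def)
  have "inc_sum G h v = (j + 1) * inc_sum G (matching_weight (verts G - {x}) f) v +
    j * inc_sum G (matching_weight (verts G - {y}) g) v +
    j * inc_sum G (\<lambda>e. of_bool (e = {x, y})) v" for v
    unfolding h_def inc_sum_def sum.distrib sum_distrib_left ..
  then have h: "inc_sum G h v = (j + 1) * of_bool (v \<in> verts G - {x}) +
    j * of_bool (v \<in> verts G - {y}) + j * of_bool (v \<in> {x, y})" for v
    using inc_sum_matching_weight[OF assms(1,7)] inc_sum_matching_weight[OF assms(1,8)]
      inc_sum_edge[OF assms(1) xy(2)] by simp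
  have hx: "inc_sum G h x = k - 1" using h[of x] assms(3) xy k by simp
  have hk: "inc_sum G h v = k" if "v \<in> verts G" "v \<noteq> x" for v
    using h[of v] that xy k by (cases "v = y") simp_all
  have "almost_perfect_int_k_matching k G h"
    unfolding almost_perfect_int_k_matching_def
  proof (intro conjI)
    have le: "inc_sum G h v \<le> k" if "v \<in> verts G" for v
      using that hx hk by (cases "v = x") simp_all
    show "int_k_matching k G h" by (rule int_k_matchingI[OF assms(1,2) le])
    show "\<exists>!u. u \<in> verts G \<and> inc_sum G h u = k - 1"
    proof (rule ex1I[of _ x])
      fix u assume "u \<in> verts G \<and> inc_sum G h u = k - 1"
      then show "u = x" using hk[of u] k by auto
    qed (use hx assms(3) in simp)
    show "\<forall>v\<in>verts G. inc_sum G h v = k \<or> inc_sum G h v = k - 1" using hx hk by blast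
  qed
  then show ?thesis by blast
qed

section \<open>Arrangement graphs with few faults\<close>

text \<open>Induction over the faulty edges, each worth one deletion. An edge whose ends carry equal
  labels is simply restored. Otherwise it is traded for the deletion of an end that shares its label
  with another vertex. If neither end does, the two labels are merged; when there are no further
  labels, at most two vertices survive and \<open>T\<close> is huge.\<close>

lemma fault_tolerant_separator_size:
  fixes l :: "'a list \<Rightarrow> 'c"
  assumes "finite FE" "2 \<le> s" "2 \<le> p" "finite A" "card A = p + s" "T \<subseteq> arrs A s"
    and "\<forall>x\<in>arrs A s - T. \<forall>i<s. \<forall>a\<in>A - set x. x[i := a] \<notin> T \<longrightarrow> {x, x[i := a]} \<notin> FE \<longrightarrow>
      l (x[i := a]) = l x"
    and "2 \<le> card (l ` (arrs A s - T))"
  shows "s * p + card (l ` (arrs A s - T)) \<le> card T + card FE + 2"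
  using assms(1,6-)
proof (induction FE arbitrary: T l rule: finite_induct)
  case empty
  then show ?case
    using arrs_separator_size[of s p A T l] assms by (simp add: compat_def)
next
  case (insert e FE)
  let ?V = "arrs A s"
  define C where "C = l ` (?V - T)"
  have finV: "finite ?V" using assms(4) by (rule finite_arrs)
  have finT: "finite T" using insert.prems(1) finV by (rule finite_subset)
  have finC: "finite C" using finV by (simp add: C_def)
  have cE: "card (insert e FE) = card FE + 1" using insert.hyps by simp
  have dep: "l (z[i := a]) = l z"
    if "z \<in> ?V - T" "i < s" "a \<in> A - set z" "z[i := a] \<notin> T" "{z, z[i := a]} \<notin> insert e FE" for z i a
    using insert.prems(2) that by blast
  \<comment> \<open>Deleting \<open>x\<close> takes care of the edge \<open>e\<close>, and no label
    is lost because \<open>x'\<close> keeps the label of \<open>x\<close>.\<close>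
  have remove: "s * p + card C \<le> card T + card (insert e FE) + 2"
    if "x \<in> e" "x \<in> ?V - T" "x' \<in> ?V - T" "x' \<noteq> x" "l x' = l x" for x x'
  proof -
    have im: "l ` (?V - insert x T) = C"
    proof -
      have "l z \<in> l ` (?V - insert x T)" if "z \<in> ?V - T" for z
        using that \<open>x' \<in> ?V - T\<close> \<open>x' \<noteq> x\<close> \<open>l x' = l x\<close> by (cases "z = x") (force intro: rev_image_eqI)+
      then show ?thesis by (auto simp: C_def)
    qed
    have "s * p + card (l ` (?V - insert x T)) \<le> card (insert x T) + card FE + 2"
    proof (rule insert.IH)
      show "insert x T \<subseteq> ?V" using insert.prems(1) that by blast
      show "2 \<le> card (l ` (?V - insert x T))" using insert.prems(3) im by (simp add: C_def)
      show "\<forall>z\<in>?V - insert x T. \<forall>i<s. \<forall>a\<in>A - set z. z[i := a] \<notin> insert x T \<longrightarrow>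
        {z, z[i := a]} \<notin> FE \<longrightarrow> l (z[i := a]) = l z"
      proof (intro ballI allI impI)
        fix z i a
        assume *: "z \<in> ?V - insert x T" "i < s" "a \<in> A - set z" "z[i := a] \<notin> insert x T"
          "{z, z[i := a]} \<notin> FE"
        then have "x \<notin> {z, z[i := a]}" by auto
        then have "{z, z[i := a]} \<noteq> e" using that(1) by blast
        then show "l (z[i := a]) = l z" using * by (intro dep) auto
      qed
    qed
    then show ?thesis using that(2) finT cE im by simp
  qed
  have "s * p + card C \<le> card T + card (insert e FE) + 2"
  proof (cases "\<exists>x\<in>?V - T. \<exists>i<s. \<exists>a\<in>A - set x. x[i := a] \<notin> T \<and> {x, x[i := a]} = e \<and> l (x[i := a]) \<noteq> l x")
    case False
    have "s * p + card C \<le> card T + card FE + 2"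
      unfolding C_def
    proof (rule insert.IH[OF insert.prems(1) _ insert.prems(3)], intro ballI allI impI)
      fix z i a
      assume *: "z \<in> ?V - T" "i < s" "a \<in> A - set z" "z[i := a] \<notin> T" "{z, z[i := a]} \<notin> FE"
      show "l (z[i := a]) = l z"
        using False dep[OF *(1-4)] * by blast
    qed
    then show ?thesis using cE by simp
  next
    case True
    then obtain x i a where x: "x \<in> ?V - T" "i < s" "a \<in> A - set x" "x[i := a] \<notin> T"
      "{x, x[i := a]} = e" "l (x[i := a]) \<noteq> l x" by blast
    define y where "y = x[i := a]"
    have y: "y \<in> ?V - T" "l y \<noteq> l x" "e = {x, y}"
      using x arrs_update[of x A s i a] by (auto simp: y_def)
    show ?thesis
    proof (cases "(\<exists>x'\<in>?V - T. x' \<noteq> x \<and> l x' = l x) \<or> (\<exists>y'\<in>?V - T. y' \<noteq> y \<and> l y' = l y)")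
      case True
      then show ?thesis using remove[of x] remove[of y] x(1) y by blast
    next
      case uniq: False
      show ?thesis
      proof (cases "card C = 2")
        case True
        have "{l x, l y} \<subseteq> C" using x(1) y(1) by (auto simp: C_def)
        then have C: "C = {l x, l y}"
          using card_subset_eq[OF finC, of "{l x, l y}"] True y(2) by simp
        have "?V - T \<subseteq> {x, y}"
        proof
          fix z assume z: "z \<in> ?V - T"
          then have "l z = l x \<or> l z = l y" using C by (auto simp: C_def)
          then show "z \<in> {x, y}" using uniq z by blast
        qed
        then have "card (?V - T) \<le> card {x, y}" by (intro card_mono) auto
        also have "\<dots> \<le> 2" by (simp add: card_insert_if)
        finally have "card ?V \<le> card T + 2"
          using card_Diff_subset[OF finT insert.prems(1)] by simp
        moreover have "(s + 1) * (p + 1) \<le> card ?V"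
          using assms by (intro card_arrs_ge) auto
        ultimately show ?thesis using True cE by simp
      next
        case False
        then have C3: "3 \<le> card C" using insert.prems(3) by (simp add: C_def)
        \<comment> \<open>The merged labelling is constant along \<open>e\<close> as well; the
          single lost label is paid for by \<open>e\<close>.\<close>
        define l' where "l' z = (if l z = l y then l x else l z)" for z
        have im: "l' ` (?V - T) = C - {l y}"
          using x(1) y by (auto simp: C_def l'_def)
        have cC: "card C = Suc (card (C - {l y}))"
          by (rule card.remove[OF finC]) (use y in \<open>auto simp: C_def\<close>)
        have "s * p + card (l' ` (?V - T)) \<le> card T + card FE + 2"
        proof (rule insert.IH[OF insert.prems(1)])
          show "2 \<le> card (l' ` (?V - T))" using C3 cC im by simp
          show "\<forall>z\<in>?V - T. \<forall>i<s. \<forall>a\<in>A - set z. z[i := a] \<notin> T \<longrightarrow>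
            {z, z[i := a]} \<notin> FE \<longrightarrow> l' (z[i := a]) = l' z"
          proof (intro ballI allI impI)
            fix z i a
            assume *: "z \<in> ?V - T" "i < s" "a \<in> A - set z" "z[i := a] \<notin> T" "{z, z[i := a]} \<notin> FE"
            show "l' (z[i := a]) = l' z"
            proof (cases "{z, z[i := a]} = e")
              case True
              then have "z = x \<and> z[i := a] = y \<or> z = y \<and> z[i := a] = x"
                using y(3) by (simp add: doubleton_eq_iff)
              then show ?thesis by (auto simp: l'_def)
            next
              case False
              then have "l (z[i := a]) = l z" using * by (intro dep) auto
              then show ?thesis by (simp add: l'_def)
            qed
          qed
        qed
        then show ?thesis using im cC cE by simp
      qed
    qed
  qed
  then show ?case unfolding C_def .
qed

section \<open>Edges and degrees of the arrangement graph\<close>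

lemma arr_verts_eq: "arr_verts n s = arrs {1..n} s"
  by (simp add: arr_verts_def arrs_def)

lemma differ_once_iff:
  assumes "u \<in> arrs A s" "w \<in> arrs A s"
  shows "card {i. i < s \<and> u ! i \<noteq> w ! i} = 1 \<longleftrightarrow> (\<exists>i<s. \<exists>a\<in>A - set u. w = u[i := a])"
proof
  have len: "length u = s" "length w = s" and dist: "distinct w" and "set w \<subseteq> A"
    using assms by (auto simp: arrs_def)
  assume "card {i. i < s \<and> u ! i \<noteq> w ! i} = 1"
  then obtain i where "{i. i < s \<and> u ! i \<noteq> w ! i} = {i}" by (auto simp: card_1_singleton_iff)
  then have i: "i < s" "u ! i \<noteq> w ! i" "\<And>j. j < s \<Longrightarrow> j \<noteq> i \<Longrightarrow> u ! j = w ! j" by blast+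
  have "w = u[i := w ! i]"
    by (rule nth_equalityI) (use len i in \<open>auto simp: nth_list_update\<close>)
  moreover have "w ! i \<notin> set u"
  proof
    assume "w ! i \<in> set u"
    then obtain j where j: "j < s" "u ! j = w ! i" using len by (auto simp: in_set_conv_nth)
    then have "j \<noteq> i" using i by auto
    then have "w ! j = w ! i" using i(3) j by simp
    then show False using dist len i(1) j(1) \<open>j \<noteq> i\<close> by (simp add: nth_eq_iff_index_eq)
  qed
  moreover have "w ! i \<in> A" using \<open>set w \<subseteq> A\<close> len i(1) by auto
  ultimately show "\<exists>i<s. \<exists>a\<in>A - set u. w = u[i := a]" using i(1) by blast
next
  assume "\<exists>i<s. \<exists>a\<in>A - set u. w = u[i := a]"
  then obtain i a where ia: "i < s" "a \<in> A - set u" "w = u[i := a]" by blast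
  have "length u = s" using assms by (auto simp: arrs_def)
  then have "u ! i \<noteq> a" using ia by auto
  then have "{j. j < s \<and> u ! j \<noteq> w ! j} = {i}"
    using ia \<open>length u = s\<close> by (auto simp: nth_list_update split: if_splits)
  then show "card {j. j < s \<and> u ! j \<noteq> w ! j} = 1" by simp
qed

lemma edges_arrangement:
  "edges (arrangement_graph n s) =
    {{u, u[i := a]} | u i a. u \<in> arrs {1..n} s \<and> i < s \<and> a \<in> {1..n} - set u}"
proof (intro set_eqI iffI)
  fix e assume "e \<in> edges (arrangement_graph n s)"
  then obtain u v where uv: "e = {u, v}" "u \<in> arrs {1..n} s" "v \<in> arrs {1..n} s"
    "card {i. i < s \<and> u ! i \<noteq> v ! i} = 1"
    by (auto simp: edges_def arrangement_graph_def arr_verts_eq)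
  then show "e \<in> {{u, u[i := a]} | u i a. u \<in> arrs {1..n} s \<and> i < s \<and> a \<in> {1..n} - set u}"
    using differ_once_iff[OF uv(2,3)] by blast
next
  fix e assume "e \<in> {{u, u[i := a]} | u i a. u \<in> arrs {1..n} s \<and> i < s \<and> a \<in> {1..n} - set u}"
  then obtain u i a where u: "e = {u, u[i := a]}" "u \<in> arrs {1..n} s" "i < s" "a \<in> {1..n} - set u"
    by blast
  then have "u[i := a] \<in> arrs {1..n} s" by (intro arrs_update)
  moreover have "card {j. j < s \<and> u ! j \<noteq> u[i := a] ! j} = 1"
    using differ_once_iff[OF u(2) calculation] u(3,4) by blast
  ultimately show "e \<in> edges (arrangement_graph n s)"
    using u(1,2) unfolding edges_def arrangement_graph_def arr_verts_eq snd_conv by blast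
qed

lemma arrangement_edgeI:
  "u \<in> arrs {1..n} s \<Longrightarrow> i < s \<Longrightarrow> a \<in> {1..n} - set u \<Longrightarrow>
    {u, u[i := a]} \<in> edges (arrangement_graph n s)"
  unfolding edges_arrangement by blast

lemma verts_arrangement: "verts (arrangement_graph n s) = arrs {1..n} s"
  by (simp add: verts_def arrangement_graph_def arr_verts_eq)

lemma edge_subset_verts:
  "e \<in> edges (arrangement_graph n s) \<Longrightarrow> e \<subseteq> arrs {1..n} s \<and> e \<noteq> {}"
  by (auto simp: edges_arrangement intro: arrs_update)

lemma finite_edges_arrangement: "finite (edges (arrangement_graph n s))"
  by (rule finite_subset[of _ "Pow (arrs {1..n} s)"])
    (use edge_subset_verts in \<open>auto simp: finite_arrs\<close>)

text \<open>The edges at \<open>v\<close> correspond to pairs of a position and a letter not in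
  \<open>v\<close>. An edge given with \<open>v\<close> as its updated end is reversed by restoring
  the old entry.\<close>

lemma degree_arrangement:
  assumes "v \<in> arrs {1..n} s"
  shows "card {e \<in> edges (arrangement_graph n s). v \<in> e} = s * (n - s)"
proof -
  have len: "length v = s" "distinct v" "set v \<subseteq> {1..n}" using assms by (auto simp: arrs_def)
  have "{e \<in> edges (arrangement_graph n s). v \<in> e} =
      (\<lambda>(i, a). {v, v[i := a]}) ` ({..<s} \<times> ({1..n} - set v))" (is "?L = ?R")
  proof (intro set_eqI iffI)
    fix e assume "e \<in> ?L"
    then obtain u i a where u: "e = {u, u[i := a]}" "u \<in> arrs {1..n} s" "i < s"
      "a \<in> {1..n} - set u" "v \<in> {u, u[i := a]}"
      by (auto simp: edges_arrangement)
    show "e \<in> ?R"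
    proof (cases "v = u")
      case True
      then show ?thesis using u by force
    next
      case False
      then have v: "v = u[i := a]" using u by simp
      have "u ! i \<in> {1..n} - set v" "v[i := u ! i] = u"
        using list_update_sym_ex[OF u(2-4)] v by simp_all
      then have "e = (\<lambda>(i, a). {v, v[i := a]}) (i, u ! i)" "(i, u ! i) \<in> {..<s} \<times> ({1..n} - set v)"
        using u v by auto
      then show ?thesis by blast
    qed
  next
    fix e assume "e \<in> ?R"
    then show "e \<in> ?L" using assms arrangement_edgeI by auto
  qed
  moreover have "inj_on (\<lambda>(i, a). {v, v[i := a]}) ({..<s} \<times> ({1..n} - set v))"
  proof (rule inj_onI, clarify)
    fix i a j b
    assume *: "i < s" "j < s" "a \<in> {1..n}" "a \<notin> set v" "b \<in> {1..n}" "b \<notin> set v"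
      "{v, v[i := a]} = {v, v[j := b]}"
    have ni: "v[i := a] ! i = a" "v[j := b] ! j = b" using * len by simp_all
    have "v ! i \<in> set v" "v ! j \<in> set v" using * len by auto
    then have "v[i := a] = v[j := b]" using * ni by (metis doubleton_eq_iff)
    then have "v[j := b] ! i = a" using ni by simp
    then have "i = j" using * len \<open>v ! i \<in> set v\<close> by (cases "i = j") auto
    then show "i = j \<and> a = b" using \<open>v[j := b] ! i = a\<close> * len by simp
  qed
  ultimately have "card {e \<in> edges (arrangement_graph n s). v \<in> e} = s * card ({1..n} - set v)"
    by (simp add: card_image card_cartesian_product)
  also have "card ({1..n} - set v) = n - s"
    using len by (subst card_Diff_subset) (auto simp: distinct_card)
  finally show ?thesis .
qed

lemma finite_edges_delete: "finite (edges (delete (arrangement_graph n s) FV FE))"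
  by (rule finite_subset[OF _ finite_edges_arrangement[of n s]]) (auto simp: delete_def edges_def)

lemma verts_delete: "verts (delete (arrangement_graph n s) FV FE) = arrs {1..n} s - FV"
  by (simp add: verts_def delete_def verts_arrangement[unfolded verts_def])

lemma edge_delete_subset:
  "e \<in> edges (delete (arrangement_graph n s) FV FE) \<Longrightarrow> e \<subseteq> arrs {1..n} s - FV \<and> e \<noteq> {}"
  using edge_subset_verts[of e n s] by (auto simp: delete_def edges_def)

lemma adjacent_deleteI:
  assumes "x \<in> arrs {1..n} s - FV" "i < s" "a \<in> {1..n} - set x" "x[i := a] \<notin> FV"
    and "{x, x[i := a]} \<notin> FE"
  shows "adjacent (delete (arrangement_graph n s) FV FE) x (x[i := a])"
proof -
  have "i < length x" using assms by (simp add: arrs_def)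
  then have "x[i := a] ! i = a" "x ! i \<in> set x" by simp_all
  then have "x \<noteq> x[i := a]" using assms(3) by auto
  moreover have "{x, x[i := a]} \<in> edges (arrangement_graph n s)"
    using assms by (intro arrangement_edgeI) auto
  then have "{x, x[i := a]} \<in> edges (delete (arrangement_graph n s) FV FE)"
    using assms by (auto simp: delete_def edges_def)
  ultimately show ?thesis by (simp add: adjacent_def)
qed

section \<open>Lower bound: fewer faults than the degree\<close>

locale faulty_arrangement =
  fixes n s p :: nat and FV :: "nat list set" and FE :: "nat list set set"
  assumes s3: "3 \<le> s" and p2: "2 \<le> p" and n: "n = p + s"
    and FV: "FV \<subseteq> arrs {1..n} s" and finFE: "finite FE"
    and few: "card FV + card FE < s * p"
begin

abbreviation "V \<equiv> arrs {1..n} s - FV"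
abbreviation "G \<equiv> delete (arrangement_graph n s) FV FE"

lemma finV: "finite V"
  by (simp add: finite_arrs)

text \<open>With \<open>FV \<union> S\<close> as the deleted vertices, \<open>c \<ge> 2\<close>
  labels require \<open>s * p + c\<close> to be at most
  \<open>card FV + card S + card FE + 2\<close>; having fewer than \<open>s * p\<close> faults
  leaves \<open>c \<le> card S + 1\<close>.\<close>

lemma labels_le:
  assumes S: "S \<subseteq> V" and cls: "constant_along (V - S) (adjacent G) cls"
  shows "card (cls ` (V - S)) \<le> card S + 1"
proof (cases "2 \<le> card (cls ` (V - S))")
  case True
  have VS: "V - S = arrs {1..n} s - (FV \<union> S)" by auto
  have "s * p + card (cls ` (V - S)) \<le> card (FV \<union> S) + card FE + 2"
    unfolding VS
  proof (rule fault_tolerant_separator_size[OF finFE _ p2])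
    show "\<forall>x\<in>arrs {1..n} s - (FV \<union> S). \<forall>i<s. \<forall>a\<in>{1..n} - set x. x[i := a] \<notin> FV \<union> S \<longrightarrow>
      {x, x[i := a]} \<notin> FE \<longrightarrow> cls (x[i := a]) = cls x"
    proof (intro ballI allI impI)
      fix x i a
      assume *: "x \<in> arrs {1..n} s - (FV \<union> S)" "i < s" "a \<in> {1..n} - set x"
        "x[i := a] \<notin> FV \<union> S" "{x, x[i := a]} \<notin> FE"
      then have "adjacent G x (x[i := a])" by (intro adjacent_deleteI) auto
      moreover have "x[i := a] \<in> arrs {1..n} s" using * by (intro arrs_update) auto
      ultimately show "cls (x[i := a]) = cls x"
        using cls * unfolding constant_along_def by force
    qed
  qed (use True VS s3 FV S n in auto)
  also have "card (FV \<union> S) \<le> card FV + card S" by (rule card_Un_le)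
  finally show ?thesis using few by linarith
qed simp

text \<open>An independent set \<open>D\<close> larger than its neighbourhood \<open>N\<close>
  leaves too many components unless \<open>N\<close> and \<open>D\<close> cover everything, so
  \<open>D\<close> contains more than half of the vertices. But sequences with a common tail form a
  clique, so apart from the faulty edges \<open>D\<close> has at most one vertex per tail, which is
  too few.\<close>

lemma barrier_impossible:
  assumes D: "D \<subseteq> V" and indep: "\<forall>x\<in>D. \<forall>y\<in>D. \<not> adjacent G x y"
  shows "card D \<le> card {x \<in> V. \<exists>v\<in>D. adjacent G v x}"
proof (rule ccontr)
  define N where "N = {x \<in> V. \<exists>v\<in>D. adjacent G v x}"
  assume "\<not> card D \<le> card {x \<in> V. \<exists>v\<in>D. adjacent G v x}"
  then have less: "card N < card D" by (simp add: N_def)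
  have sym: "adjacent G x y \<Longrightarrow> adjacent G y x" for x y
    by (auto simp: adjacent_def insert_commute)
  have finD: "finite D" using D finV by (rule finite_subset)
  have NV: "N \<subseteq> V" "N \<inter> D = {}" using indep by (auto simp: N_def)
  \<comment> \<open>Each vertex of \<open>D\<close> is isolated after removing \<open>N\<close> and
    gets its own label; everything else shares the label \<open>{}\<close>. Any vertex outside
    \<open>N\<close> and \<open>D\<close> would thus give \<open>card D + 1\<close> labels, while at
    most \<open>card N + 1 \<le> card D\<close> are allowed.\<close>
  define cls where "cls x = (if x \<in> D then {x} else {})" for x
  have "constant_along (V - N) (adjacent G) cls"
    unfolding constant_along_def
  proof (intro ballI impI)
    fix x y assume "x \<in> V - N" "y \<in> V - N" "adjacent G x y"
    then have "x \<notin> D" "y \<notin> D" using sym by (auto simp: N_def)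
    then show "cls x = cls y" by (simp add: cls_def)
  qed
  from labels_le[OF NV(1) this] have le: "card (cls ` (V - N)) \<le> card D"
    using less by linarith
  have "V - N \<subseteq> D"
  proof
    fix x assume x: "x \<in> V - N"
    show "x \<in> D"
    proof (rule ccontr)
      assume "x \<notin> D"
      have "insert {} ((\<lambda>x. {x}) ` D) \<subseteq> cls ` (V - N)"
      proof -
        have "{} = cls x" using \<open>x \<notin> D\<close> by (simp add: cls_def)
        moreover have "{v} \<in> cls ` (V - N)" if "v \<in> D" for v
          using that D NV by (intro image_eqI[of _ _ v]) (auto simp: cls_def)
        ultimately show ?thesis using x by blast
      qed
      then have "card (insert {} ((\<lambda>x. {x}) ` D)) \<le> card (cls ` (V - N))"
        using finV by (intro card_mono) auto
      moreover have "card ((\<lambda>x. {x}) ` D) = card D" by (rule card_image) simp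
      moreover have "{} \<notin> (\<lambda>x. {x}) ` D" by auto
      ultimately show False using le finD by simp
    qed
  qed
  then have "V \<subseteq> N \<union> D" by auto
  then have "card V \<le> card (N \<union> D)"
    using finD finV finite_subset[OF NV(1)] by (intro card_mono) auto
  also have "\<dots> \<le> card N + card D" by (rule card_Un_le)
  finally have "card V + 1 \<le> 2 * card D" using less by linarith
  moreover have "card (arrs {1..n} s) = card FV + card V"
    using card_Diff_subset[OF finite_subset[OF FV] FV] card_mono[OF _ FV] finite_arrs[of "{1..n}" s]
    by simp
  ultimately have 1: "card (arrs {1..n} s) + 1 \<le> 2 * card D + card FV" by simp
  obtain r where r: "s = Suc r" using s3 by (cases s) auto
  define R where "R = card (arrs {1..n} r)"
  have "card {1..n} = (p + 1) + r" using n r by simp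
  then have 2: "card (arrs {1..n} s) = (p + 1) * R"
    unfolding R_def r by (intro card_arrs_Suc) auto
  have 3: "s * (p + 2) \<le> R"
    using card_arrs_ge[of "{1..n}" "p + 2" r] n r s3 p2 by (simp add: R_def)
  \<comment> \<open>One end of every faulty edge is dropped from \<open>D\<close>; two remaining
    vertices with the same tail would then be adjacent in \<open>G\<close>.\<close>
  define pick where "pick e = (SOME x. x \<in> e)" for e :: "nat list set"
  have "inj_on tl (D - pick ` FE)"
  proof (rule inj_onI, rule ccontr)
    fix x y assume xy: "x \<in> D - pick ` FE" "y \<in> D - pick ` FE" "tl x = tl y" "x \<noteq> y"
    have "x \<in> arrs {1..n} (Suc r)" "y \<in> arrs {1..n} (Suc r)" using xy D r by auto
    then obtain a b zs where ab: "x = a # zs" "y = b # zs" "b \<in> {1..n}"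
      using xy(3) by (auto elim!: arrs_SucE)
    then have "b \<notin> set x" using xy \<open>y \<in> arrs {1..n} (Suc r)\<close> by (auto simp: arrs_def)
    moreover have y: "y = x[0 := b]" using ab by simp
    moreover have "\<not> adjacent G x y" using indep xy by blast
    ultimately have "{x, y} \<in> FE"
      using adjacent_deleteI[of x n s FV 0 b FE] xy D ab(3) s3 by auto
    then have "pick {x, y} \<in> pick ` FE" by (rule imageI)
    moreover have "pick {x, y} \<in> {x, y}" unfolding pick_def by (rule someI[of _ x]) simp
    ultimately show False using xy(1,2) by auto
  qed
  moreover have "tl ` (D - pick ` FE) \<subseteq> arrs {1..n} r"
  proof
    fix zs assume "zs \<in> tl ` (D - pick ` FE)"
    then obtain x where "x \<in> arrs {1..n} (Suc r)" "zs = tl x" using D r by auto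
    then show "zs \<in> arrs {1..n} r" by (cases x) (auto simp: arrs_def)
  qed
  ultimately have "card (D - pick ` FE) \<le> R"
    unfolding R_def using card_inj_on_le finite_arrs[of "{1..n}" r] by blast
  moreover have "card D \<le> card (D - pick ` FE) + card (pick ` FE)"
    using finD finFE card_mono[of "(D - pick ` FE) \<union> pick ` FE" D]
      card_Un_le[of "D - pick ` FE" "pick ` FE"] by auto
  moreover have "card (pick ` FE) \<le> card FE" using finFE by (rule card_image_le)
  ultimately have "card D \<le> R + card FE" by linarith
  with 1 2 few have "(p + 1) * R + 1 < 2 * R + 2 * (s * p)" by linarith
  \<comment> \<open>With \<open>q + 1 = p - 1\<close> the inequality reads
    \<open>(p - 1) * R + 1 < 2 * s * p\<close>, while \<open>R \<ge> s * (p + 2)\<close> and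
    \<open>(p - 1) * (p + 2) \<ge> 2 * p\<close> for \<open>p \<ge> 2\<close>.\<close>
  moreover obtain q where q: "p = q + 2" using p2 le_Suc_ex by (metis add.commute)
  ultimately have "(q + 1) * R + 1 < 2 * (s * p)" by (simp add: algebra_simps)
  moreover have "(q + 1) * (s * (p + 2)) \<le> (q + 1) * R" using 3 by (rule mult_le_mono2)
  moreover have "2 * (s * p) \<le> (q + 1) * (s * (p + 2))"
    unfolding q by (simp add: algebra_simps)
  ultimately show False by linarith
qed

lemma has_matching:
  assumes "odd k"
  shows "(\<exists>h. perfect_int_k_matching k G h) \<or> (\<exists>h. almost_perfect_int_k_matching k G h)"
proof -
  have sym: "adjacent G x y \<Longrightarrow> adjacent G y x" for x y
    by (auto simp: adjacent_def insert_commute)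
  have irr: "\<not> adjacent G x x" for x by (simp add: adjacent_def)
  have VG: "verts G = V" by (rule verts_delete)
  have edge: "e \<subseteq> verts G \<and> e \<noteq> {}" if "e \<in> edges G" for e
    using edge_delete_subset[OF that] VG by simp
  \<comment> \<open>The empty sequence serves as the additional vertex in
    \<open>pm_or_near_pm\<close>.\<close>
  have "[] \<notin> V" using s3 by (auto simp: arrs_def)
  moreover have "card (odd_classes (V - S) cls) \<le> card S + 1"
    if "S \<subseteq> V" "constant_along (V - S) (adjacent G) cls" for S and cls :: "nat list \<Rightarrow> nat list set"
  proof -
    have "card (odd_classes (V - S) cls) \<le> card (cls ` (V - S))"
      by (intro card_mono odd_classes_subset finite_imageI finite_Diff finV)
    then show ?thesis using labels_le[OF that] by linarith
  qed
  ultimately have pm: "if even (card V) then \<exists>f. pm V (adjacent G) f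
      else \<exists>u\<in>V. \<exists>f. pm (V - {u}) (adjacent G) f"
    using pm_or_near_pm[of V "adjacent G" "[]"] finV sym irr by blast
  show ?thesis
  proof (cases "even (card V)")
    case True
    then obtain f where "pm (verts G) (adjacent G) f" using pm VG by auto
    from perfect_from_pm[OF finite_edges_delete edge this] show ?thesis by blast
  next
    case False
    then obtain u f where "u \<in> V" "pm (V - {u}) (adjacent G) f" using pm by auto
    from adjacent_missable_or_barrier[OF finV sym irr this]
    obtain x y g h where "x \<in> V" "y \<in> V" "adjacent G x y"
      "pm (V - {x}) (adjacent G) g" "pm (V - {y}) (adjacent G) h"
      using barrier_impossible by (auto simp: not_le[symmetric])
    then have "\<exists>h. almost_perfect_int_k_matching k G h"
      using edge assms unfolding VG[symmetric]
      by (intro almost_perfect_from_two_pms[OF finite_edges_delete])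
    then show ?thesis ..
  qed
qed

end

section \<open>Upper bound: isolating one vertex\<close>

text \<open>The weight at an isolated vertex is 0, which is neither \<open>k\<close> nor
  \<open>k - 1\<close> once \<open>k \<ge> 2\<close>.\<close>

lemma isolated_vertex_no_matching:
  assumes "v \<in> verts G" "\<And>e. e \<in> edges G \<Longrightarrow> v \<notin> e" "2 \<le> k"
  shows "\<not> (\<exists>h. perfect_int_k_matching k G h)" "\<not> (\<exists>h. almost_perfect_int_k_matching k G h)"
proof -
  have "{e \<in> edges G. v \<in> e} = {}" using assms(2) by blast
  then have "inc_sum G h v = 0" for h unfolding inc_sum_def by (simp only: sum.empty)
  then have "\<not> (inc_sum G h v = k \<or> inc_sum G h v = k - 1)" for h using assms(3) by simp
  then show "\<not> (\<exists>h. perfect_int_k_matching k G h)" "\<not> (\<exists>h. almost_perfect_int_k_matching k G h)"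
    using assms(1) unfolding perfect_int_k_matching_def almost_perfect_int_k_matching_def by blast+
qed

theorem theorem3p14:
  fixes k n s :: nat
  assumes "odd k" and "k \<ge> 3" and "3 \<le> s" and "s + 2 \<le> n"
  shows "smp k (arrangement_graph n s) = s * (n - s)"
  unfolding smp_def
proof (rule Least_equality)
  let ?G = "arrangement_graph n s"
  \<comment> \<open>Any vertex would do; this one is the sequence \<open>1, ..., s\<close>, and the
    faults are all edges at it.\<close>
  define v where "v = [1..<Suc s]"
  define FE where "FE = {e \<in> edges ?G. v \<in> e}"
  have v: "v \<in> arrs {1..n} s" using assms by (auto simp: v_def arrs_def)
  have "v \<in> verts (delete ?G {} FE)" using v by (simp add: verts_delete)
  moreover have "v \<notin> e" if "e \<in> edges (delete ?G {} FE)" for e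
    using that by (auto simp: delete_def edges_def FE_def)
  ultimately have "\<not> (\<exists>h. perfect_int_k_matching k (delete ?G {} FE) h)"
    "\<not> (\<exists>h. almost_perfect_int_k_matching k (delete ?G {} FE) h)"
    using isolated_vertex_no_matching[of v "delete ?G {} FE" k] assms by auto
  moreover have "card FE = s * (n - s)" unfolding FE_def by (rule degree_arrangement[OF v])
  ultimately show "\<exists>FV FE. FV \<subseteq> verts ?G \<and> FE \<subseteq> edges ?G \<and> card FV + card FE = s * (n - s) \<and>
      \<not> (\<exists>h. perfect_int_k_matching k (delete ?G FV FE) h) \<and>
      \<not> (\<exists>h. almost_perfect_int_k_matching k (delete ?G FV FE) h)"
    by (intro exI[of _ "{}"] exI[of _ FE]) (auto simp: FE_def)
next
  let ?G = "arrangement_graph n s"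
  fix m
  assume "\<exists>FV FE. FV \<subseteq> verts ?G \<and> FE \<subseteq> edges ?G \<and> card FV + card FE = m \<and>
      \<not> (\<exists>h. perfect_int_k_matching k (delete ?G FV FE) h) \<and>
      \<not> (\<exists>h. almost_perfect_int_k_matching k (delete ?G FV FE) h)"
  then obtain FV FE where F: "FV \<subseteq> verts ?G" "FE \<subseteq> edges ?G" "card FV + card FE = m"
    "\<not> (\<exists>h. perfect_int_k_matching k (delete ?G FV FE) h)"
    "\<not> (\<exists>h. almost_perfect_int_k_matching k (delete ?G FV FE) h)" by blast
  show "s * (n - s) \<le> m"
  proof (rule ccontr)
    assume "\<not> s * (n - s) \<le> m"
    then interpret faulty_arrangement n s "n - s" FV FE
      using assms F finite_subset[OF F(2) finite_edges_arrangement]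
      by unfold_locales (auto simp: verts_arrangement)
    show False using has_matching[OF assms(1)] F by blast
  qed
qed

end
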